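(* Let $H=-\partial_x^2-i\partial_y^2$ on $\mathbb{R}^2$, let $\varepsilon>0$, $r>0$, and let $(M_\beta)_{\beta\in\mathbb{N}^2}$ be a family of nonnegative real numbers. For real $a,b>0$ with $b\le a$ put $$F_\varepsilon(a,b)=\begin{cases}a^{1/4+\varepsilon}\,b^{-1/4}&\text{if } a^{1/2}\le b\le a,\\ a^{1/8+\varepsilon}&\text{if } b\le a^{1/2}.\end{cases}$$ Then there are constants $C,\Lambda>0$, depending only on $\varepsilon,r$ and $(M_\beta)$, such that for every open set $\Omega\subset\mathbb{R}^2$, every $V\in C^\infty(\Omega,\mathbb{C})$, every $\lambda\in\mathbb{C}$, every $\psi_\lambda\in C^\infty(\Omega,\mathbb{C})$ satisfying $(H+V)\psi_\lambda=\lambda\psi_\lambda$ on $\Omega$, and every ball $B(x,r)\subset\Omega$ with $\sup_{B(x,r)}|D^\beta V|\le M_\beta$ for all $\beta\in\mathbb{N}^2$: (i) if $0<\operatorname{Im}\lambda\le\operatorname{Re}\lambda$ and $\operatorname{Re}\lambda\ge\Lambda$, then $|\psi_\lambda(x)|\le C\,F_\varepsilon(\operatorname{Re}\lambda,\operatorname{Im}\lambda)\,\|\psi_\lambda\|_{L^2(B(x,r))}$; (ii) if $0<\operatorname{Re}\lambda\le\operatorname{Im}\lambda$ and $\operatorname{Im}\lambda\ge\Lambda$, then $|\psi_\lambda(x)|\le C\,F_\varepsilon(\operatorname{Im}\lambda,\operatorname{Re}\lambda)\,\|\psi_\lambda\|_{L^2(B(x,r))}$.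
   Context: Notation: $\mathbb{N}=\{0,1,2,\dots\}$; $D^\beta=(-i\partial_x)^{\beta_1}(-i\partial_y)^{\beta_2}$ for $\beta\in\mathbb{N}^2$. $B(x,r)$ is the closed Euclidean ball in $\mathbb{R}^2$ of center $x$ and radius $r$. (In the case $b=a^{1/2}$ the two expressions defining $F_\varepsilon$ coincide.) *)

theory Defs
  imports "HOL-Analysis.Analysis"
begin

text \<open>
  The plane is \<open>real \<times> real\<close>, whose library norm is the Euclidean one. A function on an
  open set \<open>\<Omega>\<close> is a total function on the plane of which only the values on \<open>\<Omega>\<close> are
  used; since \<open>\<Omega>\<close> is open, its derivatives at points of \<open>\<Omega>\<close> depend only on those values.
\<close>

definition pdx :: "(real \<times> real \<Rightarrow> complex) \<Rightarrow> real \<times> real \<Rightarrow> complex" where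
  "pdx f = (\<lambda>(x, y). vector_derivative (\<lambda>s. f (s, y)) (at x))"

definition pdy :: "(real \<times> real \<Rightarrow> complex) \<Rightarrow> real \<times> real \<Rightarrow> complex" where
  "pdy f = (\<lambda>(x, y). vector_derivative (\<lambda>t. f (x, t)) (at y))"

text \<open>
  \<open>Ck_on k \<Omega> f\<close> is meant for open \<open>\<Omega>\<close>. Total differentiability is required in the successor
  step because \<^const>\<open>vector_derivative\<close> is an unspecified value where the derivative
  does not exist.
\<close>

primrec Ck_on :: "nat \<Rightarrow> (real \<times> real) set \<Rightarrow> (real \<times> real \<Rightarrow> complex) \<Rightarrow> bool" where
  "Ck_on 0 \<Omega> f \<longleftrightarrow> continuous_on \<Omega> f"
| "Ck_on (Suc k) \<Omega> f \<longleftrightarrow>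
     (\<forall>z\<in>\<Omega>. f differentiable (at z)) \<and> Ck_on k \<Omega> (pdx f) \<and> Ck_on k \<Omega> (pdy f)"

definition smooth_fun_on :: "(real \<times> real) set \<Rightarrow> (real \<times> real \<Rightarrow> complex) \<Rightarrow> bool" where
  "smooth_fun_on \<Omega> f \<longleftrightarrow> (\<forall>k. Ck_on k \<Omega> f)"

definition Dmulti :: "nat \<times> nat \<Rightarrow> (real \<times> real \<Rightarrow> complex) \<Rightarrow> real \<times> real \<Rightarrow> complex" where
  "Dmulti \<beta> f =
     ((\<lambda>g z. - \<i> * pdx g z) ^^ fst \<beta>) (((\<lambda>g z. - \<i> * pdy g z) ^^ snd \<beta>) f)"

definition Hop :: "(real \<times> real \<Rightarrow> complex) \<Rightarrow> real \<times> real \<Rightarrow> complex" where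
  "Hop f z = - pdx (pdx f) z - \<i> * pdy (pdy f) z"

definition L2norm_on :: "(real \<times> real) set \<Rightarrow> (real \<times> real \<Rightarrow> complex) \<Rightarrow> real" where
  "L2norm_on S f = sqrt (set_lebesgue_integral lborel S (\<lambda>z. (cmod (f z))\<^sup>2))"

text \<open>Only used for \<open>0 < b \<le> a\<close>; the two expressions agree at \<open>b = a powr (1/2)\<close>.\<close>

definition Feps :: "real \<Rightarrow> real \<Rightarrow> real \<Rightarrow> real" where
  "Feps \<epsilon> a b =
     (if a powr (1/2) \<le> b then a powr (1/4 + \<epsilon>) * b powr (- 1/4) else a powr (1/8 + \<epsilon>))"

end

theory Submission
  imports Defs
begin

text \<open>
  Put \<open>\<lambda> = a + \<i> b\<close> with \<open>0 < b \<le> a\<close>, and \<open>A = \<partial>\<^sub>x\<^sub>x + a\<close>, \<open>B = \<partial>\<^sub>y\<^sub>y + b\<close>, so that the equation reads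
  \<open>(A + \<i> B) \<psi> = V \<psi>\<close>. The operators \<open>A\<close> and \<open>B\<close> are symmetric and commute, whence
  \<open>\<parallel>(A + \<i> B) v\<parallel>\<^sup>2 = \<parallel>A v\<parallel>\<^sup>2 + \<parallel>B v\<parallel>\<^sup>2\<close> for compactly supported \<open>v\<close>. Localised by a cutoff this
  costs a commutator of the size of the gradient, that is \<open>O(sqrt a)\<close>, and yields
  \<open>\<parallel>A \<psi>\<parallel> + \<parallel>B \<psi>\<parallel> = O(sqrt a \<parallel>\<psi>\<parallel>)\<close> on a smaller square (\<open>interior_estimate\<close>). In other words
  \<open>\<psi>\<close> is, in each variable separately, an oscillator of known frequency with a small forcing.

  For an oscillator \<open>u'' + \<kappa>\<^sup>2 u = f\<close> the value at the centre of an interval of half length \<open>l\<close>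
  satisfies \<open>\<bar>u\<bar>\<^sup>2 \<le> C (\<parallel>u\<parallel>\<^sup>2 / l + l \<parallel>f\<parallel>\<^sup>2 / \<kappa>\<^sup>2)\<close>, by conservation of energy
  (\<open>interval_bound\<close>). With \<open>\<kappa> = sqrt a\<close> and \<open>l\<close> of order one this is used in the variable \<open>x\<close>, for \<open>\<psi>\<close> and
  for \<open>B \<psi>\<close>, which satisfies the differentiated equation: no power of \<open>a\<close> is lost in
  passing to the vertical line through the centre. On that line let \<open>\<beta> = max b (sqrt a)\<close>. The bound with
  \<open>\<kappa> = sqrt \<beta>\<close>, \<open>\<parallel>f\<parallel> = O(sqrt a)\<close> and the optimal \<open>l\<close> of order \<open>sqrt (\<beta> / a)\<close> gives
  \<open>\<bar>\<psi>\<bar> \<le> C (a / \<beta>) powr (1/4) \<parallel>\<psi>\<parallel>\<close> (\<open>jet_eigenfunction_bound\<close>), and this power is the one in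
  \<open>Feps\<close>.

  The second half of the theorem is the first one for the complex conjugate of \<open>\<psi>\<close> with the
  two variables exchanged (\<open>jet_on_reflect\<close>).
\<close>

section \<open>Smooth functions as families of partial derivatives\<close>

text \<open>
  The argument differentiates the equation, adds solutions, exchanges the two variables and takes
  complex conjugates. On the family of all partial derivatives each of these is a mere
  reindexing, so that regularity is dealt with once, when a smooth function is turned into such
  a family.
\<close>

definition jet_on :: "(real \<times> real) set \<Rightarrow> (nat \<Rightarrow> nat \<Rightarrow> real \<times> real \<Rightarrow> complex) \<Rightarrow> bool" where
  "jet_on \<Omega> U \<longleftrightarrow> (\<forall>i j. continuous_on \<Omega> (U i j)) \<and>
     (\<forall>i j x y. (x, y) \<in> \<Omega> \<longrightarrow>
        ((\<lambda>t. U i j (t, y)) has_vector_derivative U (Suc i) j (x, y)) (at x) \<and>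
        ((\<lambda>t. U i j (x, t)) has_vector_derivative U i (Suc j) (x, y)) (at y))"

lemma jet_on_cont: "jet_on \<Omega> U \<Longrightarrow> S \<subseteq> \<Omega> \<Longrightarrow> continuous_on S (U i j)"
  unfolding jet_on_def using continuous_on_subset by blast

lemma jet_on_dx: "jet_on \<Omega> U \<Longrightarrow> (x, y) \<in> \<Omega> \<Longrightarrow>
    ((\<lambda>t. U i j (t, y)) has_vector_derivative U (Suc i) j (x, y)) (at x within S)"
  unfolding jet_on_def using has_vector_derivative_at_within by blast

lemma jet_on_dy: "jet_on \<Omega> U \<Longrightarrow> (x, y) \<in> \<Omega> \<Longrightarrow>
    ((\<lambda>t. U i j (x, t)) has_vector_derivative U i (Suc j) (x, y)) (at y within S)"
  unfolding jet_on_def using has_vector_derivative_at_within by blast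

lemma smooth_fun_on_pdx: "smooth_fun_on \<Omega> f \<Longrightarrow> smooth_fun_on \<Omega> (pdx f)"
  and smooth_fun_on_pdy: "smooth_fun_on \<Omega> f \<Longrightarrow> smooth_fun_on \<Omega> (pdy f)"
  and smooth_fun_on_continuous: "smooth_fun_on \<Omega> f \<Longrightarrow> continuous_on \<Omega> f"
  and smooth_fun_on_differentiable: "smooth_fun_on \<Omega> f \<Longrightarrow> z \<in> \<Omega> \<Longrightarrow> f differentiable (at z)"
  unfolding smooth_fun_on_def using Ck_on.simps by blast+

lemma has_vector_derivative_pdx:
  assumes "f differentiable (at (x, y))"
  shows "((\<lambda>t. f (t, y)) has_vector_derivative pdx f (x, y)) (at x)"
proof -
  have "((\<lambda>t. (t, y)) has_derivative (\<lambda>h. (h, 0))) (at x)"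
    by (auto intro!: derivative_eq_intros)
  then have "(\<lambda>t. f (t, y)) differentiable (at x)"
    using differentiable_chain_at[of "\<lambda>t. (t, y)" x f] assms by (auto simp: differentiable_def o_def)
  then show ?thesis
    by (simp add: pdx_def vector_derivative_works)
qed

lemma has_vector_derivative_pdy:
  assumes "f differentiable (at (x, y))"
  shows "((\<lambda>t. f (x, t)) has_vector_derivative pdy f (x, y)) (at y)"
proof -
  have "((\<lambda>t. (x, t)) has_derivative (\<lambda>h. (0, h))) (at y)"
    by (auto intro!: derivative_eq_intros)
  then have "(\<lambda>t. f (x, t)) differentiable (at y)"
    using differentiable_chain_at[of "\<lambda>t. (x, t)" y f] assms by (auto simp: differentiable_def o_def)
  then show ?thesis
    by (simp add: pdy_def vector_derivative_works)
qed

lemma open_box: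
  assumes "open \<Omega>" "(x, y) \<in> \<Omega>"
  obtains d :: real where "d > 0" "{x - d..x + d} \<times> {y - d..y + d} \<subseteq> \<Omega>"
proof -
  obtain A B where AB: "open A" "open B" "x \<in> A" "y \<in> B" "A \<times> B \<subseteq> \<Omega>"
    using open_prod_elim[OF assms] by (metis mem_Sigma_iff)
  obtain d1 where d1: "d1 > 0" "cball x d1 \<subseteq> A" using AB open_contains_cball by blast
  obtain d2 where d2: "d2 > 0" "cball y d2 \<subseteq> B" using AB open_contains_cball by blast
  show ?thesis
  proof (rule that[of "min d1 d2"])
    have "{x - min d1 d2..x + min d1 d2} \<subseteq> cball x d1"
         "{y - min d1 d2..y + min d1 d2} \<subseteq> cball y d2"
      by (auto simp: cball_eq_atLeastAtMost)
    then show "{x - min d1 d2..x + min d1 d2} \<times> {y - min d1 d2..y + min d1 d2} \<subseteq> \<Omega>"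
      using AB d1(2) d2(2) by blast
  qed (use d1 d2 in auto)
qed

text \<open>
  Clairaut's theorem. On a small box
  \<open>f (t, s) = f (a, s) + (integral over [a, t] of pdx f (\<tau>, s) in \<tau>)\<close>; differentiating under
  the integral sign in \<open>s\<close> exhibits \<open>pdy f\<close> as a primitive of \<open>pdy (pdx f)\<close> in the first variable.
\<close>

lemma mixed_partials_commute:
  assumes \<Omega>: "open \<Omega>" and f: "smooth_fun_on \<Omega> f" and z: "(x, y) \<in> \<Omega>"
  shows "((\<lambda>t. pdy f (t, y)) has_vector_derivative pdy (pdx f) (x, y)) (at x)"
proof -
  obtain d where d: "d > 0" and sub: "{x - d..x + d} \<times> {y - d..y + d} \<subseteq> \<Omega>"
    using open_box[OF \<Omega> z] .
  let ?I = "{x - d..x + d}" and ?J = "{y - d..y + d}"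
  let ?a = "x - d"
  have diff: "f differentiable (at (t, s))" "pdx f differentiable (at (t, s))"
    if "t \<in> ?I" "s \<in> ?J" for t s
    using that sub smooth_fun_on_differentiable[OF f]
      smooth_fun_on_differentiable[OF smooth_fun_on_pdx[OF f]] by blast+
  have cont: "continuous_on (?I \<times> ?J) (pdx f)" "continuous_on (?I \<times> ?J) (pdy (pdx f))"
    using f sub by (meson continuous_on_subset smooth_fun_on_continuous smooth_fun_on_pdx
        smooth_fun_on_pdy)+
  have contx: "continuous_on {?a..t} (\<lambda>\<tau>. g (\<tau>, s))"
    if "continuous_on (?I \<times> ?J) g" "t \<in> ?I" "s \<in> ?J" for t s and g :: "real \<times> real \<Rightarrow> complex"
    by (rule continuous_on_compose2[OF that(1)]) (use that in \<open>auto intro!: continuous_intros\<close>)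
  have ftc: "((\<lambda>\<tau>. pdx f (\<tau>, s)) has_integral f (t, s) - f (?a, s)) {?a..t}"
    if "t \<in> ?I" "s \<in> ?J" for t s
  proof (rule fundamental_theorem_of_calculus)
    show "((\<lambda>\<tau>. f (\<tau>, s)) has_vector_derivative pdx f (\<tau>, s)) (at \<tau> within {?a..t})"
      if "\<tau> \<in> {?a..t}" for \<tau>
      by (rule has_vector_derivative_at_within[OF has_vector_derivative_pdx[OF diff(1)]])
         (use \<open>t \<in> ?I\<close> \<open>s \<in> ?J\<close> that in auto)
  qed (use that in auto)
  have key: "pdy f (t, y) = pdy f (?a, y) + integral {?a..t} (\<lambda>\<tau>. pdy (pdx f) (\<tau>, y))"
    if t: "t \<in> ?I" for t
  proof -
    have 1: "((\<lambda>s. integral (cbox ?a t) (\<lambda>\<tau>. pdx f (\<tau>, s))) has_vector_derivative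
          integral (cbox ?a t) (\<lambda>\<tau>. pdy (pdx f) (\<tau>, y))) (at y within ?J)"
    proof (rule leibniz_rule_vector_derivative)
      show "((\<lambda>s. pdx f (\<tau>, s)) has_vector_derivative pdy (pdx f) (\<tau>, s)) (at s within ?J)"
        if "s \<in> ?J" "\<tau> \<in> cbox ?a t" for s \<tau>
        by (rule has_vector_derivative_at_within[OF has_vector_derivative_pdy[OF diff(2)]])
           (use that t in auto)
      show "(\<lambda>\<tau>. pdx f (\<tau>, s)) integrable_on cbox ?a t" if "s \<in> ?J" for s
        using ftc[OF t that] by auto
      show "continuous_on (?J \<times> cbox ?a t) (\<lambda>(s, \<tau>). pdy (pdx f) (\<tau>, s))"
        unfolding split_beta
        by (rule continuous_on_compose2[OF cont(2)]) (use t in \<open>auto intro!: continuous_intros\<close>)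
    qed (use d in auto)
    have 2: "((\<lambda>s. f (t, s) - f (?a, s)) has_vector_derivative pdy f (t, y) - pdy f (?a, y))
        (at y within ?J)"
      by (rule has_vector_derivative_at_within[OF has_vector_derivative_diff[OF
            has_vector_derivative_pdy[OF diff(1)] has_vector_derivative_pdy[OF diff(1)]]])
         (use t d in auto)
    have 3: "((\<lambda>s. f (t, s) - f (?a, s)) has_vector_derivative
          integral (cbox ?a t) (\<lambda>\<tau>. pdy (pdx f) (\<tau>, y))) (at y within ?J)"
      by (rule has_vector_derivative_transform[OF _ _ 1])
         (use integral_unique[OF ftc[OF t]] d in auto)
    have "pdy f (t, y) - pdy f (?a, y) = integral (cbox ?a t) (\<lambda>\<tau>. pdy (pdx f) (\<tau>, y))"
      by (rule vector_derivative_unique_within[OF _ 2 3])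
         (use d in \<open>simp add: at_within_Icc_at\<close>)
    then show ?thesis by (simp add: algebra_simps)
  qed
  have "((\<lambda>t. integral {?a..t} (\<lambda>\<tau>. pdy (pdx f) (\<tau>, y))) has_vector_derivative
      pdy (pdx f) (x, y)) (at x within ?I)"
    by (rule integral_has_vector_derivative) (use contx[OF cont(2), of "x + d" y] d in auto)
  then have "((\<lambda>t. pdy f (?a, y) + integral {?a..t} (\<lambda>\<tau>. pdy (pdx f) (\<tau>, y)))
      has_vector_derivative pdy (pdx f) (x, y)) (at x within ?I)"
    by (auto intro!: derivative_eq_intros)
  then have "((\<lambda>t. pdy f (t, y)) has_vector_derivative pdy (pdx f) (x, y)) (at x within ?I)"
    by (rule has_vector_derivative_transform[rotated 2]) (use d in \<open>simp_all only: key\<close>, simp_all)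
  then show ?thesis using d by (simp add: at_within_Icc_at)
qed

lemma pdx_cong_on:
  assumes "open \<Omega>" "z \<in> \<Omega>" "\<And>w. w \<in> \<Omega> \<Longrightarrow> f w = g w"
  shows "pdx f z = pdx g z"
proof -
  obtain x y where xy: "z = (x, y)" by force
  obtain d where d: "d > 0" "{x - d..x + d} \<times> {y - d..y + d} \<subseteq> \<Omega>"
    using open_box assms xy by metis
  have "eventually (\<lambda>t. t \<in> {x - d<..<x + d}) (nhds x)"
    using d by (intro eventually_nhds_in_open) auto
  then have "eventually (\<lambda>t. f (t, y) = g (t, y)) (nhds x)"
    by (rule eventually_mono) (intro assms(3) subsetD[OF d(2)], auto)
  then show ?thesis
    unfolding pdx_def xy by (auto intro!: vector_derivative_cong_eq)
qed

lemma smooth_imp_jet_on: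
  assumes \<Omega>: "open \<Omega>" and f: "smooth_fun_on \<Omega> f"
  shows "jet_on \<Omega> (\<lambda>i j. (pdx ^^ i) ((pdy ^^ j) f))"
proof -
  have sm: "smooth_fun_on \<Omega> ((pdx ^^ i) ((pdy ^^ j) f))" for i j
  proof (induction i)
    case 0
    show ?case by (induction j) (auto intro: f smooth_fun_on_pdy)
  qed (auto intro: smooth_fun_on_pdx)
  have comm: "pdy ((pdx ^^ i) ((pdy ^^ j) f)) z = (pdx ^^ i) ((pdy ^^ Suc j) f) z"
    if "z \<in> \<Omega>" for i j z
    using that
  proof (induction i arbitrary: z)
    case (Suc i)
    let ?g = "(pdx ^^ i) ((pdy ^^ j) f)"
    obtain x y where z: "z = (x, y)" by force
    have "pdx (pdy ?g) z = pdy (pdx ?g) z"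
      using mixed_partials_commute[OF \<Omega> sm, of x y] Suc.prems
      by (auto simp: pdx_def z intro: vector_derivative_at)
    moreover have "pdx (pdy ?g) z = pdx ((pdx ^^ i) ((pdy ^^ Suc j) f)) z"
      by (rule pdx_cong_on[OF \<Omega> Suc.prems Suc.IH])
    ultimately show ?case by simp
  qed auto
  show ?thesis
    unfolding jet_on_def
  proof (intro conjI allI impI)
    fix i j and x y :: real
    assume z: "(x, y) \<in> \<Omega>"
    note diff = smooth_fun_on_differentiable[OF sm z, of i j]
    show "((\<lambda>t. (pdx ^^ i) ((pdy ^^ j) f) (t, y)) has_vector_derivative
        (pdx ^^ Suc i) ((pdy ^^ j) f) (x, y)) (at x)"
      using has_vector_derivative_pdx[OF diff] by simp
    show "((\<lambda>t. (pdx ^^ i) ((pdy ^^ j) f) (x, t)) has_vector_derivative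
        (pdx ^^ i) ((pdy ^^ Suc j) f) (x, y)) (at y)"
      using has_vector_derivative_pdy[OF diff] comm[OF z] by simp
  qed (rule smooth_fun_on_continuous[OF sm])
qed

section \<open>A pointwise bound in one variable\<close>

text \<open>
  Young's inequality with a free parameter, by which every lower-order term below is absorbed.
\<close>

lemma prod_le_squares: "p * r \<le> t * p\<^sup>2 + r\<^sup>2 / (4 * t)" if "t > 0" for p r t :: real
proof -
  have "0 \<le> (2 * t * p - r)\<^sup>2 / (4 * t)" using that by simp
  also have "\<dots> = t * p\<^sup>2 + r\<^sup>2 / (4 * t) - p * r"
    using that by (simp add: power2_eq_square field_simps)
  finally show ?thesis by simp
qed

lemma has_vector_derivative_Re:
  "(f has_vector_derivative f') F \<Longrightarrow> ((\<lambda>t. Re (f t)) has_real_derivative Re f') F"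
  and has_vector_derivative_Im:
  "(f has_vector_derivative f') F \<Longrightarrow> ((\<lambda>t. Im (f t)) has_real_derivative Im f') F"
  unfolding has_real_derivative_iff_has_vector_derivative
  by (auto intro: bounded_linear.has_vector_derivative bounded_linear_Re bounded_linear_Im)

lemma cutoff_bounds:
  fixes l t c :: real
  assumes "l > 0" "t \<in> {c - l..c + l}"
  shows "0 \<le> 1 - ((t - c) / l)\<^sup>2" "1 - ((t - c) / l)\<^sup>2 \<le> 1" "\<bar>2 * (t - c) / l\<^sup>2\<bar> \<le> 2 / l"
proof -
  have "\<bar>(t - c) / l\<bar> \<le> 1" using assms by (auto simp: abs_le_iff field_simps)
  then show "0 \<le> 1 - ((t - c) / l)\<^sup>2" by (simp add: abs_square_le_1)
  have "\<bar>2 * (t - c) / l\<^sup>2\<bar> = \<bar>(t - c) / l\<bar> * (2 / l)"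
  proof -
    have "2 * (t - c) / l\<^sup>2 = (t - c) / l * (2 / l)" by (simp add: power2_eq_square)
    then show ?thesis using assms(1) by (simp only: abs_mult) simp
  qed
  also have "\<dots> \<le> 1 * (2 / l)"
    using \<open>\<bar>(t - c) / l\<bar> \<le> 1\<close> assms(1) by (intro mult_right_mono) auto
  finally show "\<bar>2 * (t - c) / l\<^sup>2\<bar> \<le> 2 / l" by simp
qed simp

text \<open>
  The bracket on the right is the derivative of \<open>q\<^sup>2 Re (cnj u u')\<close> when \<open>v = u'\<close> and \<open>w = u''\<close>.
  It integrates to zero for a cutoff \<open>q\<close> that vanishes at both ends, which leaves a bound for
  the weighted integral of \<open>\<bar>u'\<bar>\<^sup>2\<close>.
\<close>

lemma interval_gradient_pointwise:
  fixes u v w :: complex and q q' l \<kappa> :: real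
  assumes "0 \<le> q" "q \<le> 1" "\<bar>q'\<bar> \<le> 2 / l" "l > 0" "\<kappa> > 0"
  defines "f \<equiv> w + (\<kappa>\<^sup>2) * u"
  shows "q\<^sup>2 * (cmod v)\<^sup>2 \<le> 2 * (2 * q * q' * Re (cnj u * v) + q\<^sup>2 * (cmod v)\<^sup>2 + q\<^sup>2 * Re (cnj u * w))
           + (16 / l\<^sup>2 + 3 * \<kappa>\<^sup>2) * (cmod u)\<^sup>2 + (cmod f)\<^sup>2 / \<kappa>\<^sup>2"
proof -
  have R: "\<bar>Re (cnj u * z)\<bar> \<le> cmod u * cmod z" for z
    using abs_Re_le_cmod[of "cnj u * z"] by (simp add: norm_mult)
  have "- (2 * q * q' * Re (cnj u * v)) \<le> 2 * q * \<bar>q'\<bar> * \<bar>Re (cnj u * v)\<bar>"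
    using assms(1) abs_ge_minus_self[of "2 * q * q' * Re (cnj u * v)"] by (simp add: abs_mult)
  also have "\<dots> \<le> 2 * q * \<bar>q'\<bar> * (cmod u * cmod v)"
    using R assms(1) by (intro mult_left_mono) auto
  also have "\<dots> = (q * cmod v) * (2 * \<bar>q'\<bar> * cmod u)" by simp
  also have "\<dots> \<le> (1/2) * (q * cmod v)\<^sup>2 + (2 * \<bar>q'\<bar> * cmod u)\<^sup>2 / (4 * (1/2))"
    by (rule prod_le_squares) simp
  also have "\<dots> = q\<^sup>2 * (cmod v)\<^sup>2 / 2 + 2 * \<bar>q'\<bar>\<^sup>2 * (cmod u)\<^sup>2"
    by (simp add: power_mult_distrib)
  also have "\<dots> \<le> q\<^sup>2 * (cmod v)\<^sup>2 / 2 + 2 * (2 / l)\<^sup>2 * (cmod u)\<^sup>2"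
    using assms by (intro add_left_mono mult_right_mono mult_left_mono power_mono) auto
  finally have 1: "- (2 * q * q' * Re (cnj u * v)) \<le> q\<^sup>2 * (cmod v)\<^sup>2 / 2 + 8 / l\<^sup>2 * (cmod u)\<^sup>2"
    by (simp add: power_divide)
  have w: "Re (cnj u * w) = Re (cnj u * f) - \<kappa>\<^sup>2 * (cmod u)\<^sup>2"
    unfolding f_def cmod_power2 by (simp add: algebra_simps power2_eq_square)
  have q2: "q\<^sup>2 \<le> 1" using assms by (simp add: power_le_one)
  have "- (q\<^sup>2 * Re (cnj u * f)) \<le> q\<^sup>2 * \<bar>Re (cnj u * f)\<bar>"
    using abs_ge_minus_self[of "q\<^sup>2 * Re (cnj u * f)"] by (simp add: abs_mult)
  also have "\<dots> \<le> 1 * (cmod u * cmod f)"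
    using R q2 by (intro mult_mono) auto
  also have "\<dots> \<le> \<kappa>\<^sup>2 / 2 * (cmod u)\<^sup>2 + (cmod f)\<^sup>2 / (4 * (\<kappa>\<^sup>2 / 2))"
    using prod_le_squares[of "\<kappa>\<^sup>2 / 2" "cmod u" "cmod f"] assms(5) by simp
  finally have 2: "- (q\<^sup>2 * Re (cnj u * f)) \<le> \<kappa>\<^sup>2 / 2 * (cmod u)\<^sup>2 + (cmod f)\<^sup>2 / \<kappa>\<^sup>2 / 2"
    by simp
  have 3: "q\<^sup>2 * (\<kappa>\<^sup>2 * (cmod u)\<^sup>2) \<le> 1 * (\<kappa>\<^sup>2 * (cmod u)\<^sup>2)"
    using q2 by (intro mult_right_mono) auto
  show ?thesis using 1 2 3 unfolding w by (simp add: algebra_simps)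
qed

text \<open>
  The left-hand side is the derivative of \<open>q ^ 3 * E\<close>, where
  \<open>E = \<bar>u'\<bar>\<^sup>2 + \<kappa>\<^sup>2 \<bar>u\<bar>\<^sup>2\<close> is the energy of the oscillator \<open>u'' + \<kappa>\<^sup>2 u = f\<close>. One factor \<open>q\<close> is lost
  to the derivative; the remaining \<open>q\<^sup>2\<close> is the weight for which \<open>\<bar>u'\<bar>\<^sup>2\<close> is under control.
\<close>

lemma interval_energy_pointwise:
  fixes u v w :: complex and q q' l \<kappa> :: real
  assumes "0 \<le> q" "q \<le> 1" "\<bar>q'\<bar> \<le> 2 / l" "l > 0"
  defines "f \<equiv> w + (\<kappa>\<^sup>2) * u"
  shows "3 * q\<^sup>2 * q' * ((cmod v)\<^sup>2 + \<kappa>\<^sup>2 * (cmod u)\<^sup>2) + 2 * q ^ 3 * Re (cnj v * f)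
     \<le> 7 / l * (q\<^sup>2 * (cmod v)\<^sup>2) + 6 * \<kappa>\<^sup>2 / l * (cmod u)\<^sup>2 + l * (cmod f)\<^sup>2"
proof -
  have q2: "q\<^sup>2 \<le> 1" using assms by (simp add: power_le_one)
  have "3 * q\<^sup>2 * q' * ((cmod v)\<^sup>2 + \<kappa>\<^sup>2 * (cmod u)\<^sup>2)
      = q' * (3 * q\<^sup>2 * ((cmod v)\<^sup>2 + \<kappa>\<^sup>2 * (cmod u)\<^sup>2))" by simp
  also have "\<dots> \<le> 2 / l * (3 * q\<^sup>2 * ((cmod v)\<^sup>2 + \<kappa>\<^sup>2 * (cmod u)\<^sup>2))"
    using assms by (intro mult_right_mono) auto
  also have "\<dots> = 6 / l * (q\<^sup>2 * (cmod v)\<^sup>2) + q\<^sup>2 * (6 * \<kappa>\<^sup>2 / l * (cmod u)\<^sup>2)"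
    by (simp add: field_simps add_divide_distrib)
  also have "\<dots> \<le> 6 / l * (q\<^sup>2 * (cmod v)\<^sup>2) + 1 * (6 * \<kappa>\<^sup>2 / l * (cmod u)\<^sup>2)"
    using q2 assms by (intro add_left_mono mult_right_mono) auto
  finally have 1: "3 * q\<^sup>2 * q' * ((cmod v)\<^sup>2 + \<kappa>\<^sup>2 * (cmod u)\<^sup>2)
      \<le> 6 / l * (q\<^sup>2 * (cmod v)\<^sup>2) + 6 * \<kappa>\<^sup>2 / l * (cmod u)\<^sup>2" by simp
  have "2 * q ^ 3 * Re (cnj v * f) \<le> 2 * q ^ 3 * (cmod v * cmod f)"
    using complex_Re_le_cmod[of "cnj v * f"] assms(1) by (intro mult_left_mono) (auto simp: norm_mult)
  also have "\<dots> = q\<^sup>2 * ((q * cmod v) * (2 * cmod f))" by (simp add: power3_eq_cube power2_eq_square)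
  also have "\<dots> \<le> 1 * ((q * cmod v) * (2 * cmod f))"
    using q2 assms by (intro mult_right_mono) auto
  also have "\<dots> \<le> 1 / l * (q * cmod v)\<^sup>2 + (2 * cmod f)\<^sup>2 / (4 * (1 / l))"
    using prod_le_squares[of "1 / l" "q * cmod v" "2 * cmod f"] assms(4) by simp
  finally have 2: "2 * q ^ 3 * Re (cnj v * f) \<le> 1 / l * (q\<^sup>2 * (cmod v)\<^sup>2) + l * (cmod f)\<^sup>2"
    by (simp add: power_mult_distrib mult.commute)
  show ?thesis using 1 2 by (simp add: add_divide_distrib algebra_simps)
qed

text \<open>
  The energy \<open>\<bar>u'\<bar>\<^sup>2 + \<kappa>\<^sup>2 \<bar>u\<bar>\<^sup>2\<close> of an oscillator of frequency \<open>\<kappa>\<close> changes only through the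
  forcing \<open>u'' + \<kappa>\<^sup>2 u\<close>, so that its value at the centre is at most its average plus the
  work of the forcing. The frequency therefore costs nothing, unlike in the Sobolev
  inequality. The condition \<open>1 / l \<le> m * \<kappa>\<close> makes the interval at least comparable with a wavelength.
\<close>

lemma interval_bound:
  fixes u u1 u2 :: "real \<Rightarrow> complex" and c l \<kappa> m :: real
  assumes "l > 0" "\<kappa> > 0" "m \<ge> 1" and lm: "1 / l \<le> m * \<kappa>"
    and u1: "\<And>t. t \<in> {c - l..c + l} \<Longrightarrow> (u has_vector_derivative u1 t) (at t within {c - l..c + l})"
    and u2: "\<And>t. t \<in> {c - l..c + l} \<Longrightarrow> (u1 has_vector_derivative u2 t) (at t within {c - l..c + l})"
    and cont: "continuous_on {c - l..c + l} u2"
  shows "\<kappa>\<^sup>2 * (cmod (u c))\<^sup>2 \<le> 139 * m\<^sup>2 *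
      (\<kappa>\<^sup>2 / l * integral {c - l..c + l} (\<lambda>t. (cmod (u t))\<^sup>2)
        + l * integral {c - l..c + l} (\<lambda>t. (cmod (u2 t + \<kappa>\<^sup>2 * u t))\<^sup>2))"
proof -
  let ?I = "{c - l..c + l}"
  define q where "q = (\<lambda>t. 1 - ((t - c) / l)\<^sup>2)"
  define q' where "q' = (\<lambda>t. - (2 * (t - c) / l\<^sup>2))"
  define f where "f = (\<lambda>t. u2 t + \<kappa>\<^sup>2 * u t)"
  have q: "0 \<le> q t" "q t \<le> 1" "\<bar>q' t\<bar> \<le> 2 / l" if "t \<in> ?I" for t
    using cutoff_bounds[OF \<open>l > 0\<close> that] by (auto simp: q_def q'_def)
  have cu: "continuous_on ?I u" "continuous_on ?I u1"
    unfolding continuous_on_eq_continuous_within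
    using has_vector_derivative_continuous[OF u1] has_vector_derivative_continuous[OF u2] by auto
  have cf: "continuous_on ?I f"
    unfolding f_def by (intro continuous_intros cu cont)
  have cq: "continuous_on ?I q" unfolding q_def using assms(1) by (auto intro!: continuous_intros)
  define X where "X = integral ?I (\<lambda>t. (cmod (u t))\<^sup>2)"
  define F where "F = integral ?I (\<lambda>t. (cmod (f t))\<^sup>2)"
  define Y where "Y = integral ?I (\<lambda>t. (q t)\<^sup>2 * (cmod (u1 t))\<^sup>2)"
  have intX: "((\<lambda>t. (cmod (u t))\<^sup>2) has_integral X) ?I"
    and intF: "((\<lambda>t. (cmod (f t))\<^sup>2) has_integral F) ?I"
    and intY: "((\<lambda>t. (q t)\<^sup>2 * (cmod (u1 t))\<^sup>2) has_integral Y) ?I"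
    unfolding X_def F_def Y_def
    by (intro integrable_integral integrable_continuous_real continuous_intros cu cf cq)+
  have X0: "X \<ge> 0" "F \<ge> 0" "Y \<ge> 0"
    by (rule has_integral_nonneg[OF intX] has_integral_nonneg[OF intF] has_integral_nonneg[OF intY]; simp)+
  note D = has_vector_derivative_Re[OF u1] has_vector_derivative_Im[OF u1]
    has_vector_derivative_Re[OF u2] has_vector_derivative_Im[OF u2]
  have Dq: "(q has_real_derivative q' t) (at t within S)" for t S
    unfolding q_def q'_def using assms(1)
    by (auto intro!: derivative_eq_intros simp: field_simps power2_eq_square)
  have "((\<lambda>t. 2 * q t * q' t * Re (cnj (u t) * u1 t) + (q t)\<^sup>2 * (cmod (u1 t))\<^sup>2
      + (q t)\<^sup>2 * Re (cnj (u t) * u2 t)) has_integral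
      (q (c + l))\<^sup>2 * Re (cnj (u (c + l)) * u1 (c + l)) -
      (q (c - l))\<^sup>2 * Re (cnj (u (c - l)) * u1 (c - l))) ?I"
  proof (rule fundamental_theorem_of_calculus)
    fix t assume t: "t \<in> ?I"
    have "((\<lambda>t. (q t)\<^sup>2 * (Re (u t) * Re (u1 t) + Im (u t) * Im (u1 t))) has_real_derivative
       2 * q t * q' t * (Re (u t) * Re (u1 t) + Im (u t) * Im (u1 t)) +
       (q t)\<^sup>2 * (Re (u1 t) * Re (u1 t) + Im (u1 t) * Im (u1 t)
          + Re (u t) * Re (u2 t) + Im (u t) * Im (u2 t))) (at t within ?I)"
      by (rule derivative_eq_intros D[OF t] Dq refl | simp add: algebra_simps)+
    then show "((\<lambda>t. (q t)\<^sup>2 * Re (cnj (u t) * u1 t)) has_vector_derivative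
       2 * q t * q' t * Re (cnj (u t) * u1 t) + (q t)\<^sup>2 * (cmod (u1 t))\<^sup>2
      + (q t)\<^sup>2 * Re (cnj (u t) * u2 t)) (at t within ?I)"
      unfolding has_real_derivative_iff_has_vector_derivative[symmetric] cmod_power2
      by (simp add: algebra_simps power2_eq_square)
  qed (use assms in auto)
  moreover have "q (c + l) = 0" "q (c - l) = 0" using assms(1) by (auto simp: q_def)
  ultimately have div: "((\<lambda>t. 2 * q t * q' t * Re (cnj (u t) * u1 t) + (q t)\<^sup>2 * (cmod (u1 t))\<^sup>2
      + (q t)\<^sup>2 * Re (cnj (u t) * u2 t)) has_integral 0) ?I" by simp
  have "Y \<le> 2 * 0 + (16 / l\<^sup>2 + 3 * \<kappa>\<^sup>2) * X + F / \<kappa>\<^sup>2"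
  proof (rule has_integral_le[OF intY])
    show "((\<lambda>t. 2 * (2 * q t * q' t * Re (cnj (u t) * u1 t) + (q t)\<^sup>2 * (cmod (u1 t))\<^sup>2
        + (q t)\<^sup>2 * Re (cnj (u t) * u2 t)) + (16 / l\<^sup>2 + 3 * \<kappa>\<^sup>2) * (cmod (u t))\<^sup>2
        + (cmod (f t))\<^sup>2 / \<kappa>\<^sup>2) has_integral 2 * 0 + (16 / l\<^sup>2 + 3 * \<kappa>\<^sup>2) * X + F / \<kappa>\<^sup>2) ?I"
      by (intro has_integral_add has_integral_mult_right has_integral_divide div intX intF)
  qed (use interval_gradient_pointwise q assms in \<open>auto simp: f_def\<close>)
  also have "\<dots> \<le> 19 * (m\<^sup>2 * \<kappa>\<^sup>2) * X + m\<^sup>2 * l\<^sup>2 * F"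
  proof -
    have "(1 / l)\<^sup>2 \<le> (m * \<kappa>)\<^sup>2" using lm assms by (intro power_mono) auto
    then have 1: "1 / l\<^sup>2 \<le> m\<^sup>2 * \<kappa>\<^sup>2" by (simp add: power_divide power_mult_distrib)
    then have 2: "1 / \<kappa>\<^sup>2 \<le> m\<^sup>2 * l\<^sup>2" using assms by (simp add: field_simps)
    have "1 * \<kappa>\<^sup>2 \<le> m\<^sup>2 * \<kappa>\<^sup>2" using assms by (intro mult_right_mono) auto
    with 1 have "16 / l\<^sup>2 + 3 * \<kappa>\<^sup>2 \<le> 19 * (m\<^sup>2 * \<kappa>\<^sup>2)" by simp
    then have "(16 / l\<^sup>2 + 3 * \<kappa>\<^sup>2) * X \<le> 19 * (m\<^sup>2 * \<kappa>\<^sup>2) * X"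
      using X0 by (intro mult_right_mono)
    moreover have "1 / \<kappa>\<^sup>2 * F \<le> m\<^sup>2 * l\<^sup>2 * F" using 2 X0 by (intro mult_right_mono)
    ultimately show ?thesis by simp
  qed
  finally have Yle: "Y \<le> 19 * (m\<^sup>2 * \<kappa>\<^sup>2) * X + m\<^sup>2 * l\<^sup>2 * F" .
  let ?h = "\<lambda>t. 7 / l * ((q t)\<^sup>2 * (cmod (u1 t))\<^sup>2) + 6 * \<kappa>\<^sup>2 / l * (cmod (u t))\<^sup>2 + l * (cmod (f t))\<^sup>2"
  have inth: "(?h has_integral 7 / l * Y + 6 * \<kappa>\<^sup>2 / l * X + l * F) ?I"
    by (intro has_integral_add has_integral_mult_right intX intF intY)
  have sub: "{c - l..c} \<subseteq> ?I" using assms by auto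
  have D': "((\<lambda>t. (q t) ^ 3 * ((cmod (u1 t))\<^sup>2 + \<kappa>\<^sup>2 * (cmod (u t))\<^sup>2)) has_vector_derivative
      3 * (q t)\<^sup>2 * q' t * ((cmod (u1 t))\<^sup>2 + \<kappa>\<^sup>2 * (cmod (u t))\<^sup>2) + 2 * (q t) ^ 3 * Re (cnj (u1 t) * f t))
      (at t within {c - l..c})" if "t \<in> {c - l..c}" for t
  proof -
    have t: "t \<in> ?I" using that sub by auto
    note D'' = D[OF t, THEN DERIV_subset, OF sub]
    have "((\<lambda>t. (q t) ^ 3 * ((Re (u1 t))\<^sup>2 + (Im (u1 t))\<^sup>2 + \<kappa>\<^sup>2 * ((Re (u t))\<^sup>2 + (Im (u t))\<^sup>2))) has_real_derivative
       3 * (q t)\<^sup>2 * q' t * ((Re (u1 t))\<^sup>2 + (Im (u1 t))\<^sup>2 + \<kappa>\<^sup>2 * ((Re (u t))\<^sup>2 + (Im (u t))\<^sup>2))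
        + (q t) ^ 3 * (2 * Re (u1 t) * Re (u2 t) + 2 * Im (u1 t) * Im (u2 t)
           + \<kappa>\<^sup>2 * (2 * Re (u t) * Re (u1 t) + 2 * Im (u t) * Im (u1 t)))) (at t within {c - l..c})"
      by (rule derivative_eq_intros D'' Dq refl | simp add: algebra_simps)+
    then show ?thesis
      unfolding has_real_derivative_iff_has_vector_derivative[symmetric] cmod_power2 f_def
      by (simp add: algebra_simps)
  qed
  have "((\<lambda>t. 3 * (q t)\<^sup>2 * q' t * ((cmod (u1 t))\<^sup>2 + \<kappa>\<^sup>2 * (cmod (u t))\<^sup>2) + 2 * (q t) ^ 3 * Re (cnj (u1 t) * f t))
     has_integral (q c) ^ 3 * ((cmod (u1 c))\<^sup>2 + \<kappa>\<^sup>2 * (cmod (u c))\<^sup>2)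
       - (q (c - l)) ^ 3 * ((cmod (u1 (c - l)))\<^sup>2 + \<kappa>\<^sup>2 * (cmod (u (c - l)))\<^sup>2)) {c - l..c}"
    by (rule fundamental_theorem_of_calculus) (use assms D' in auto)
  moreover have "q c = 1" by (simp add: q_def)
  ultimately have E: "((\<lambda>t. 3 * (q t)\<^sup>2 * q' t * ((cmod (u1 t))\<^sup>2 + \<kappa>\<^sup>2 * (cmod (u t))\<^sup>2) + 2 * (q t) ^ 3 * Re (cnj (u1 t) * f t))
     has_integral ((cmod (u1 c))\<^sup>2 + \<kappa>\<^sup>2 * (cmod (u c))\<^sup>2)) {c - l..c}"
    using \<open>q (c - l) = 0\<close> by simp
  have inth': "?h integrable_on {c - l..c}"
    by (rule integrable_on_subinterval[OF has_integral_integrable[OF inth] sub])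
  have "(cmod (u1 c))\<^sup>2 + \<kappa>\<^sup>2 * (cmod (u c))\<^sup>2 \<le> integral {c - l..c} ?h"
    by (rule has_integral_le[OF E integrable_integral[OF inth']])
       (use interval_energy_pointwise[OF q(1) q(2) q(3)] sub assms(1) in \<open>auto simp: f_def\<close>)
  also have "\<dots> \<le> 7 / l * Y + 6 * \<kappa>\<^sup>2 / l * X + l * F"
    unfolding integral_unique[OF inth, symmetric]
    by (rule integral_subset_le) (use sub inth inth' assms(1) in auto)
  also have "\<dots> \<le> 7 / l * (19 * (m\<^sup>2 * \<kappa>\<^sup>2) * X + m\<^sup>2 * l\<^sup>2 * F) + 6 * \<kappa>\<^sup>2 / l * X + l * F"
    using Yle assms(1) by (intro add_right_mono mult_left_mono) auto
  also have "\<dots> = 133 * m\<^sup>2 * (\<kappa>\<^sup>2 / l * X) + 6 * (1 * (\<kappa>\<^sup>2 / l * X)) + 7 * m\<^sup>2 * (l * F) + 1 * (l * F)"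
    using assms(1) by (simp add: field_simps power2_eq_square)
  also have "\<dots> \<le> 133 * m\<^sup>2 * (\<kappa>\<^sup>2 / l * X) + 6 * (m\<^sup>2 * (\<kappa>\<^sup>2 / l * X)) + 7 * m\<^sup>2 * (l * F) + 132 * m\<^sup>2 * (l * F)"
  proof -
    have "1 \<le> m\<^sup>2" using assms(3) by simp
    moreover from this have "1 \<le> 132 * m\<^sup>2" by linarith
    ultimately show ?thesis using X0 assms(1)
      by (intro add_mono mult_left_mono mult_right_mono order_refl) auto
  qed
  also have "\<dots> = 139 * m\<^sup>2 * (\<kappa>\<^sup>2 / l * X + l * F)" by (simp add: algebra_simps)
  finally show ?thesis unfolding X_def F_def f_def
    by (smt (verit) zero_le_power2)
qed

section \<open>An interior energy estimate\<close>

text \<open>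
  Squares replace discs, as they permit iterated integrals and polynomial product cutoffs.
\<close>

definition sq :: "real \<Rightarrow> real \<Rightarrow> real \<Rightarrow> (real \<times> real) set" where
  "sq x y s = cbox (x - s, y - s) (x + s, y + s)"

lemma mem_sq: "(p, q) \<in> sq x y s \<longleftrightarrow> p \<in> {x - s..x + s} \<and> q \<in> {y - s..y + s}"
  by (auto simp: sq_def cbox_Pair_eq)

lemma sq_mono: "s' \<le> s \<Longrightarrow> sq x y s' \<subseteq> sq x y s"
  by (auto simp: mem_sq)

lemma sq_iterated_integrals:
  fixes f :: "real \<times> real \<Rightarrow> real"
  assumes "continuous_on (sq x y s) f"
  shows "integral (sq x y s) f = integral {x - s..x + s} (\<lambda>p. integral {y - s..y + s} (\<lambda>q. f (p, q)))"
    and "integral (sq x y s) f = integral {y - s..y + s} (\<lambda>q. integral {x - s..x + s} (\<lambda>p. f (p, q)))"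
  using integral_prod_continuous[of "x - s" "y - s" "x + s" "y + s" f]
    integral_swap_continuous[of "x - s" "y - s" "x + s" "y + s" "\<lambda>p q. f (p, q)"] assms
  by (simp_all add: sq_def)

lemma integral_dx_eq_0:
  fixes h h' :: "real \<times> real \<Rightarrow> real"
  assumes "s > 0" and cont: "continuous_on (sq x y s) h'"
    and D: "\<And>p q. (p, q) \<in> sq x y s \<Longrightarrow> ((\<lambda>t. h (t, q)) has_real_derivative h' (p, q)) (at p)"
    and 0: "\<And>q. h (x - s, q) = 0" "\<And>q. h (x + s, q) = 0"
  shows "(h' has_integral 0) (sq x y s)"
proof -
  have "integral {x - s..x + s} (\<lambda>p. h' (p, q)) = 0" if "q \<in> {y - s..y + s}" for q
  proof -
    have "((\<lambda>p. h' (p, q)) has_integral h (x + s, q) - h (x - s, q)) {x - s..x + s}"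
      using D that \<open>s > 0\<close>
      by (intro fundamental_theorem_of_calculus)
         (auto simp: mem_sq has_real_derivative_iff_has_vector_derivative[symmetric]
            intro: has_field_derivative_at_within)
    then show ?thesis using 0 by (simp add: integral_unique)
  qed
  then have "integral {y - s..y + s} (\<lambda>q. integral {x - s..x + s} (\<lambda>p. h' (p, q)))
      = integral {y - s..y + s} (\<lambda>q. 0)" by (rule integral_cong)
  then have "integral (sq x y s) h' = 0"
    by (simp add: sq_iterated_integrals(2)[OF cont])
  then show ?thesis
    using integrable_continuous cont integrable_integral unfolding sq_def by metis
qed

lemma integral_dy_eq_0:
  fixes h h' :: "real \<times> real \<Rightarrow> real"
  assumes "s > 0" and cont: "continuous_on (sq x y s) h'"
    and D: "\<And>p q. (p, q) \<in> sq x y s \<Longrightarrow> ((\<lambda>t. h (p, t)) has_real_derivative h' (p, q)) (at q)"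
    and 0: "\<And>p. h (p, y - s) = 0" "\<And>p. h (p, y + s) = 0"
  shows "(h' has_integral 0) (sq x y s)"
proof -
  have "integral {y - s..y + s} (\<lambda>q. h' (p, q)) = 0" if "p \<in> {x - s..x + s}" for p
  proof -
    have "((\<lambda>q. h' (p, q)) has_integral h (p, y + s) - h (p, y - s)) {y - s..y + s}"
      using D that \<open>s > 0\<close>
      by (intro fundamental_theorem_of_calculus)
         (auto simp: mem_sq has_real_derivative_iff_has_vector_derivative[symmetric]
            intro: has_field_derivative_at_within)
    then show ?thesis using 0 by (simp add: integral_unique)
  qed
  then have "integral {x - s..x + s} (\<lambda>p. integral {y - s..y + s} (\<lambda>q. h' (p, q)))
      = integral {x - s..x + s} (\<lambda>p. 0)" by (rule integral_cong)
  then have "integral (sq x y s) h' = 0"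
    by (simp add: sq_iterated_integrals(1)[OF cont])
  then show ?thesis
    using integrable_continuous cont integrable_integral unfolding sq_def by metis
qed

text \<open>
  The arguments stand for a cutoff \<open>w\<close> with its derivatives, for \<open>u\<close> with its first derivatives, and
  for \<open>A = u\<^sub>x\<^sub>x + a u\<close> and \<open>B = u\<^sub>y\<^sub>y + b u\<close>. Both expressions are divergences of fields that vanish
  where \<open>w\<close> does (lemmas \<open>cross_divergence_eq\<close> and \<open>gradient_divergence_eq\<close>). The first one
  expresses that the symmetric operators \<open>A\<close> and \<open>B\<close> commute, so that \<open>Im (A * cnj B)\<close> has integral
  zero up to terms in which the cutoff is differentiated. The second one is the usual energy
  identity for \<open>A + B\<close>.
\<close>

definition cross_divergence :: "real \<Rightarrow> real \<Rightarrow> real \<Rightarrow> real \<Rightarrow> complex \<Rightarrow> complex \<Rightarrow> complex \<Rightarrow> complex \<Rightarrow> real" where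
  "cross_divergence w wx wy wxy ux uy A B = w ^ 4 * Im (A * cnj B) + 4 * w ^ 3 * wx * Im (ux * cnj B)
     + 4 * w ^ 3 * wy * Im (A * cnj uy) + (12 * w\<^sup>2 * wx * wy + 4 * w ^ 3 * wxy) * Im (ux * cnj uy)"

definition gradient_divergence :: "real \<Rightarrow> real \<Rightarrow> real \<Rightarrow> real \<Rightarrow> real \<Rightarrow> complex \<Rightarrow> complex \<Rightarrow> complex \<Rightarrow> complex \<Rightarrow> complex \<Rightarrow> real" where
  "gradient_divergence w wx wy a b u ux uy A B = w\<^sup>2 * ((cmod ux)\<^sup>2 + (cmod uy)\<^sup>2)
     + 2 * w * wx * Re (ux * cnj u) + 2 * w * wy * Re (uy * cnj u)
     + w\<^sup>2 * Re ((A + B) * cnj u) - (a + b) * w\<^sup>2 * (cmod u)\<^sup>2"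

lemma abs_Im_mult_cnj_le: "\<bar>Im (p * cnj q)\<bar> \<le> cmod p * cmod q"
  and abs_Re_mult_cnj_le: "\<bar>Re (p * cnj q)\<bar> \<le> cmod p * cmod q"
  using abs_Im_le_cmod[of "p * cnj q"] abs_Re_le_cmod[of "p * cnj q"] by (simp_all add: norm_mult)

lemma weighted_term_le:
  fixes c z p r :: real
  assumes "\<bar>z\<bar> \<le> p * r" "\<bar>c\<bar> \<le> e" "0 \<le> p" "0 \<le> r"
  shows "c * z \<le> e * (p * r)" "- (c * z) \<le> e * (p * r)"
proof -
  have "\<bar>c * z\<bar> \<le> e * (p * r)"
    unfolding abs_mult using assms by (intro mult_mono) auto
  then show "c * z \<le> e * (p * r)" "- (c * z) \<le> e * (p * r)" by linarith+
qed

text \<open>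
  Since \<open>\<bar>A + \<i> B\<bar>\<^sup>2 = \<bar>A\<bar>\<^sup>2 + \<bar>B\<bar>\<^sup>2 + 2 Im (A * cnj B)\<close>, the vanishing of the cross term lets \<open>A + \<i> B\<close>
  control \<open>A\<close> and \<open>B\<close> separately. The weight \<open>w ^ 4\<close> is chosen so that a derivative
  of it is bounded by the product of the square roots of the weights \<open>w ^ 4\<close> of \<open>B\<close> and \<open>w\<^sup>2\<close> of the gradient.
\<close>

lemma pointwise_second_order:
  fixes A B ux uy :: complex and w wx wy wxy k :: real
  assumes "0 \<le> w" "w \<le> 1" "\<bar>wx\<bar> \<le> k" "\<bar>wy\<bar> \<le> k" "\<bar>wxy\<bar> \<le> k\<^sup>2" "k > 0"
  shows "w ^ 4 * ((cmod A)\<^sup>2 + (cmod B)\<^sup>2) / 2 \<le> (cmod (A + \<i> * B))\<^sup>2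
     + 48 * k\<^sup>2 * (w\<^sup>2 * ((cmod ux)\<^sup>2 + (cmod uy)\<^sup>2)) - 2 * cross_divergence w wx wy wxy ux uy A B"
proof -
  have g: "(cmod (A + \<i> * B))\<^sup>2 = (cmod A)\<^sup>2 + (cmod B)\<^sup>2 + 2 * Im (A * cnj B)"
    unfolding cmod_power2 by (simp add: power2_eq_square algebra_simps)
  have w4: "w ^ 4 * (cmod (A + \<i> * B))\<^sup>2 \<le> 1 * (cmod (A + \<i> * B))\<^sup>2"
    using assms by (intro mult_right_mono power_le_one) auto
  have quad: "2 * (4 * w ^ 3 * k) * (p * r) \<le> w ^ 4 * r\<^sup>2 / 2 + 32 * k\<^sup>2 * (w\<^sup>2 * p\<^sup>2)" for p r
  proof -
    have "2 * (4 * w ^ 3 * k) * (p * r) = (w\<^sup>2 * r) * (8 * k * w * p)"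
      by (simp add: power2_eq_square power3_eq_cube)
    also have "\<dots> \<le> (1/2) * (w\<^sup>2 * r)\<^sup>2 + (8 * k * w * p)\<^sup>2 / (4 * (1/2))"
      by (rule prod_le_squares) simp
    finally show ?thesis by (simp add: power_mult_distrib mult_ac)
  qed
  have cx: "\<bar>4 * w ^ 3 * wx\<bar> \<le> 4 * w ^ 3 * k" "\<bar>4 * w ^ 3 * wy\<bar> \<le> 4 * w ^ 3 * k"
    using assms by (auto simp: abs_mult intro!: mult_left_mono)
  have 1: "2 * (4 * w ^ 3 * wx * Im (ux * cnj B)) \<le> w ^ 4 * (cmod B)\<^sup>2 / 2 + 32 * k\<^sup>2 * (w\<^sup>2 * (cmod ux)\<^sup>2)"
    using weighted_term_le(1)[OF abs_Im_mult_cnj_le cx(1), of ux B] quad[of "cmod ux" "cmod B"] by simp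
  have 2: "2 * (4 * w ^ 3 * wy * Im (A * cnj uy)) \<le> w ^ 4 * (cmod A)\<^sup>2 / 2 + 32 * k\<^sup>2 * (w\<^sup>2 * (cmod uy)\<^sup>2)"
    using weighted_term_le(1)[OF abs_Im_mult_cnj_le cx(2), of A uy] quad[of "cmod uy" "cmod A"]
    by (simp add: mult.commute)
  have "\<bar>12 * w\<^sup>2 * wx * wy + 4 * w ^ 3 * wxy\<bar> \<le> \<bar>12 * w\<^sup>2 * wx * wy\<bar> + \<bar>4 * w ^ 3 * wxy\<bar>"
    by (rule abs_triangle_ineq)
  also have "\<dots> = 12 * w\<^sup>2 * (\<bar>wx\<bar> * \<bar>wy\<bar>) + 4 * (w\<^sup>2 * w) * \<bar>wxy\<bar>"
    using assms(1) by (simp add: abs_mult power2_eq_square power3_eq_cube)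
  also have "\<dots> \<le> 12 * w\<^sup>2 * (k * k) + 4 * (w\<^sup>2 * 1) * k\<^sup>2"
    using assms by (intro add_mono mult_mono order_refl) auto
  also have "\<dots> = 16 * k\<^sup>2 * w\<^sup>2" by (simp add: power2_eq_square)
  finally have c: "\<bar>12 * w\<^sup>2 * wx * wy + 4 * w ^ 3 * wxy\<bar> \<le> 16 * k\<^sup>2 * w\<^sup>2" .
  have "(12 * w\<^sup>2 * wx * wy + 4 * w ^ 3 * wxy) * Im (ux * cnj uy) \<le> 16 * k\<^sup>2 * w\<^sup>2 * (cmod ux * cmod uy)"
    by (rule weighted_term_le(1)[OF abs_Im_mult_cnj_le c]) auto
  also have "\<dots> \<le> 16 * k\<^sup>2 * w\<^sup>2 * (1/2 * (cmod ux)\<^sup>2 + (cmod uy)\<^sup>2 / (4 * (1/2)))"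
    using prod_le_squares[of "1/2" "cmod ux" "cmod uy"] by (intro mult_left_mono) auto
  finally have 3: "2 * ((12 * w\<^sup>2 * wx * wy + 4 * w ^ 3 * wxy) * Im (ux * cnj uy))
      \<le> 16 * k\<^sup>2 * (w\<^sup>2 * ((cmod ux)\<^sup>2 + (cmod uy)\<^sup>2))"
    by (simp add: algebra_simps)
  have "w ^ 4 * (cmod A)\<^sup>2 + w ^ 4 * (cmod B)\<^sup>2 + 2 * (w ^ 4 * Im (A * cnj B)) \<le> (cmod (A + \<i> * B))\<^sup>2"
    using w4 unfolding g distrib_left by (simp only: mult.left_commute mult_1)
  moreover have "(p + q) / 2 \<le> G + (x + y + z) - 2 * (d0 + d1 + d2 + d3)"
    if "p + q + 2 * d0 \<le> G" "2 * d1 \<le> q / 2 + x" "2 * d2 \<le> p / 2 + y" "2 * d3 \<le> z"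
    for p q x y z G d0 d1 d2 d3 :: real
    using that by argo
  ultimately have "(w ^ 4 * (cmod A)\<^sup>2 + w ^ 4 * (cmod B)\<^sup>2) / 2 \<le> (cmod (A + \<i> * B))\<^sup>2
      + (32 * k\<^sup>2 * (w\<^sup>2 * (cmod ux)\<^sup>2) + 32 * k\<^sup>2 * (w\<^sup>2 * (cmod uy)\<^sup>2)
      + 16 * k\<^sup>2 * (w\<^sup>2 * ((cmod ux)\<^sup>2 + (cmod uy)\<^sup>2))) - 2 * cross_divergence w wx wy wxy ux uy A B"
    using 1 2 3 unfolding cross_divergence_def by blast
  also have "32 * k\<^sup>2 * (w\<^sup>2 * (cmod ux)\<^sup>2) + 32 * k\<^sup>2 * (w\<^sup>2 * (cmod uy)\<^sup>2)
      + 16 * k\<^sup>2 * (w\<^sup>2 * ((cmod ux)\<^sup>2 + (cmod uy)\<^sup>2)) = 48 * k\<^sup>2 * (w\<^sup>2 * ((cmod ux)\<^sup>2 + (cmod uy)\<^sup>2))"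
    by (simp add: distrib_left)
  finally show ?thesis by (simp only: distrib_left)
qed

lemma pointwise_first_order:
  fixes A B u ux uy :: complex and w wx wy k a b T :: real
  assumes "0 \<le> w" "w \<le> 1" "\<bar>wx\<bar> \<le> k" "\<bar>wy\<bar> \<le> k" "k > 0" "T > 0" "0 \<le> b" "b \<le> a"
  shows "w\<^sup>2 * ((cmod ux)\<^sup>2 + (cmod uy)\<^sup>2) / 2 \<le> gradient_divergence w wx wy a b u ux uy A B
     + (4 * k\<^sup>2 + 2 * a + 2 * T) * (cmod u)\<^sup>2 + w ^ 4 * ((cmod A)\<^sup>2 + (cmod B)\<^sup>2) / (4 * T)"
proof -
  have w2: "w\<^sup>2 \<le> 1" using assms by (simp add: power_le_one)
  have cx: "\<bar>2 * w * wx\<bar> \<le> 2 * w * k" "\<bar>2 * w * wy\<bar> \<le> 2 * w * k"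
    using assms by (auto simp: abs_mult intro!: mult_left_mono)
  have quad: "2 * w * k * (p * r) \<le> w\<^sup>2 * p\<^sup>2 / 2 + 2 * k\<^sup>2 * r\<^sup>2" for p r
  proof -
    have "2 * w * k * (p * r) = (w * p) * (2 * k * r)" by simp
    also have "\<dots> \<le> (1/2) * (w * p)\<^sup>2 + (2 * k * r)\<^sup>2 / (4 * (1/2))"
      by (rule prod_le_squares) simp
    finally show ?thesis by (simp add: power_mult_distrib)
  qed
  have 1: "- (2 * w * wx * Re (ux * cnj u)) \<le> w\<^sup>2 * (cmod ux)\<^sup>2 / 2 + 2 * k\<^sup>2 * (cmod u)\<^sup>2"
    by (rule order_trans[OF weighted_term_le(2)[OF abs_Re_mult_cnj_le cx(1)] quad]) simp_all
  have 2: "- (2 * w * wy * Re (uy * cnj u)) \<le> w\<^sup>2 * (cmod uy)\<^sup>2 / 2 + 2 * k\<^sup>2 * (cmod u)\<^sup>2"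
    by (rule order_trans[OF weighted_term_le(2)[OF abs_Re_mult_cnj_le cx(2)] quad]) simp_all
  have 3: "- (w\<^sup>2 * Re (z * cnj u)) \<le> w ^ 4 * (cmod z)\<^sup>2 / (4 * T) + T * (cmod u)\<^sup>2" for z
  proof -
    have "- (w\<^sup>2 * Re (z * cnj u)) \<le> w\<^sup>2 * (cmod z * cmod u)"
      by (rule weighted_term_le(2)[OF abs_Re_mult_cnj_le]) auto
    also have "\<dots> = cmod u * (w\<^sup>2 * cmod z)" by simp
    also have "\<dots> \<le> T * (cmod u)\<^sup>2 + (w\<^sup>2 * cmod z)\<^sup>2 / (4 * T)"
      by (rule prod_le_squares) (use assms in simp)
    finally show ?thesis by (simp add: power_mult_distrib)
  qed
  have 4: "(a + b) * w\<^sup>2 * (cmod u)\<^sup>2 \<le> 2 * a * 1 * (cmod u)\<^sup>2"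
    using assms w2 by (intro mult_right_mono mult_mono) auto
  have 5: "(p + q) / 2 \<le> (p + q + d1 + d2 + (e1 + e2) - m) + (4 * k\<^sup>2 + 2 * a + 2 * T) * n + (f1 + f2)"
    if "- d1 \<le> p / 2 + 2 * k\<^sup>2 * n" "- d2 \<le> q / 2 + 2 * k\<^sup>2 * n" "- e1 \<le> f1 + T * n"
      "- e2 \<le> f2 + T * n" "m \<le> 2 * a * 1 * n" for p q d1 d2 e1 e2 f1 f2 m n :: real
    using that by (simp add: distrib_right)
  have 6: "w\<^sup>2 * (p + q) = w\<^sup>2 * p + w\<^sup>2 * q" "w ^ 4 * (p + q) / (4 * T) = w ^ 4 * p / (4 * T) + w ^ 4 * q / (4 * T)"
    "Re ((A + B) * cnj u) = Re (A * cnj u) + Re (B * cnj u)" for p q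
    by (simp_all add: distrib_left distrib_right add_divide_distrib)
  show ?thesis
    unfolding gradient_divergence_def 6 by (rule 5[OF 1 2 3 3 4])
qed

text \<open>
  A multiple \<open>T\<close> of the first-order inequality is added to the second-order one. Half of \<open>T\<close> exceeds
  the gradient coefficient of the latter by \<open>48 k\<^sup>2\<close>, while only half of the second-order terms is used up.
\<close>

lemma pointwise_energy:
  fixes A B u ux uy :: complex and w wx wy wxy k a b :: real
  assumes "0 \<le> w" "w \<le> 1" "\<bar>wx\<bar> \<le> k" "\<bar>wy\<bar> \<le> k" "\<bar>wxy\<bar> \<le> k\<^sup>2" "k > 0" "0 \<le> b" "b \<le> a" "1 \<le> a"
  defines "T \<equiv> 192 * k\<^sup>2"
  shows "w ^ 4 * ((cmod A)\<^sup>2 + (cmod B)\<^sup>2) / 4 + 48 * k\<^sup>2 * (w\<^sup>2 * ((cmod ux)\<^sup>2 + (cmod uy)\<^sup>2))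
    \<le> (cmod (A + \<i> * B))\<^sup>2 + T * (4 * k\<^sup>2 + 2 + 2 * T) * (a * (cmod u)\<^sup>2)
       + (T * gradient_divergence w wx wy a b u ux uy A B - 2 * cross_divergence w wx wy wxy ux uy A B)"
proof -
  have T: "T > 0" using assms by (simp add: T_def)
  note 1 = pointwise_second_order[OF assms(1-6), of A B ux uy]
  have "T * (w\<^sup>2 * ((cmod ux)\<^sup>2 + (cmod uy)\<^sup>2) / 2) \<le> T * (gradient_divergence w wx wy a b u ux uy A B
     + (4 * k\<^sup>2 + 2 * a + 2 * T) * (cmod u)\<^sup>2 + w ^ 4 * ((cmod A)\<^sup>2 + (cmod B)\<^sup>2) / (4 * T))"
    using pointwise_first_order[OF assms(1-4,6) T assms(7,8)] T by (intro mult_left_mono) auto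
  also have "\<dots> = T * gradient_divergence w wx wy a b u ux uy A B + T * (4 * k\<^sup>2 + 2 * a + 2 * T) * (cmod u)\<^sup>2
      + w ^ 4 * ((cmod A)\<^sup>2 + (cmod B)\<^sup>2) / 4"
  proof -
    have "T * (D + M * U + z / (4 * T)) = T * D + T * M * U + z / 4" for D M U z :: real
      using T by (simp add: distrib_left)
    then show ?thesis .
  qed
  finally have 2: "T * (w\<^sup>2 * ((cmod ux)\<^sup>2 + (cmod uy)\<^sup>2) / 2) \<le> T * gradient_divergence w wx wy a b u ux uy A B
      + T * (4 * k\<^sup>2 + 2 * a + 2 * T) * (cmod u)\<^sup>2 + w ^ 4 * ((cmod A)\<^sup>2 + (cmod B)\<^sup>2) / 4" .
  have "4 * k\<^sup>2 + 2 * T \<le> (4 * k\<^sup>2 + 2 * T) * a"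
    using mult_left_mono[OF assms(9), of "4 * k\<^sup>2 + 2 * T"] T by simp
  then have "T * (4 * k\<^sup>2 + 2 * a + 2 * T) * (cmod u)\<^sup>2 \<le> T * ((4 * k\<^sup>2 + 2 + 2 * T) * a) * (cmod u)\<^sup>2"
    using T by (intro mult_right_mono mult_left_mono) (auto simp: algebra_simps)
  then have 3: "T * (4 * k\<^sup>2 + 2 * a + 2 * T) * (cmod u)\<^sup>2 \<le> T * (4 * k\<^sup>2 + 2 + 2 * T) * (a * (cmod u)\<^sup>2)"
    by (simp only: mult.assoc)
  have "T * (w\<^sup>2 * ((cmod ux)\<^sup>2 + (cmod uy)\<^sup>2) / 2) = 96 * k\<^sup>2 * (w\<^sup>2 * ((cmod ux)\<^sup>2 + (cmod uy)\<^sup>2))"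
    by (simp add: T_def)
  from 2[unfolded this] have 2: "96 * k\<^sup>2 * (w\<^sup>2 * ((cmod ux)\<^sup>2 + (cmod uy)\<^sup>2)) \<le> T * gradient_divergence w wx wy a b u ux uy A B
      + T * (4 * k\<^sup>2 + 2 * a + 2 * T) * (cmod u)\<^sup>2 + w ^ 4 * ((cmod A)\<^sup>2 + (cmod B)\<^sup>2) / 4" .
  have "x / 4 + 48 * k\<^sup>2 * z \<le> G + K + (d2 - 2 * d1)"
    if "x / 2 \<le> G + 48 * k\<^sup>2 * z - 2 * d1" "96 * k\<^sup>2 * z \<le> d2 + L + x / 4" "L \<le> K"
    for x z G K L d1 d2 :: real
    using that by simp
  from this[OF 1 2 3] show ?thesis .
qed

lemma has_derivative_mult_cnj:
  assumes "(p has_vector_derivative p') (at t)" "(q has_vector_derivative q') (at t)"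
  shows "((\<lambda>t. Im (p t * cnj (q t))) has_real_derivative Im (p' * cnj (q t)) + Im (p t * cnj q')) (at t)"
    and "((\<lambda>t. Re (p t * cnj (q t))) has_real_derivative Re (p' * cnj (q t)) + Re (p t * cnj q')) (at t)"
proof -
  note D = has_vector_derivative_Re[OF assms(1)] has_vector_derivative_Im[OF assms(1)]
    has_vector_derivative_Re[OF assms(2)] has_vector_derivative_Im[OF assms(2)]
  have "((\<lambda>t. Im (p t) * Re (q t) - Re (p t) * Im (q t)) has_real_derivative
      Im p' * Re (q t) + Re q' * Im (p t) - (Re p' * Im (q t) + Im q' * Re (p t))) (at t)"
    by (intro DERIV_diff DERIV_mult D)
  then show "((\<lambda>t. Im (p t * cnj (q t))) has_real_derivative Im (p' * cnj (q t)) + Im (p t * cnj q')) (at t)"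
    by (simp add: algebra_simps)
  have "((\<lambda>t. Re (p t) * Re (q t) + Im (p t) * Im (q t)) has_real_derivative
      Re p' * Re (q t) + Re q' * Re (p t) + (Im p' * Im (q t) + Im q' * Im (p t))) (at t)"
    by (intro DERIV_add DERIV_mult D)
  then show "((\<lambda>t. Re (p t * cnj (q t))) has_real_derivative Re (p' * cnj (q t)) + Re (p t * cnj q')) (at t)"
    by (simp add: algebra_simps)
qed

text \<open>
  The two summands are the \<open>x\<close>- and the \<open>y\<close>-derivative of
  \<open>w ^ 4 * Im (u\<^sub>x cnj B) + 4 w ^ 3 w\<^sub>y * Im (u\<^sub>x cnj u\<^sub>y)\<close> and of
  \<open>w ^ 4 * (a Im (u cnj u\<^sub>y) - Im (u\<^sub>x cnj u\<^sub>x\<^sub>y))\<close>.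
\<close>

lemma cross_divergence_eq:
  fixes u ux uy uxx uyy uxy uxyy :: complex and w wx wy wxy a b :: real
  defines "A \<equiv> uxx + a * u" and "B \<equiv> uyy + b * u"
  shows "cross_divergence w wx wy wxy ux uy A B =
      (4 * w ^ 3 * wx * Im (ux * cnj B) + w ^ 4 * (Im (uxx * cnj B) + Im (ux * cnj (uxyy + b * ux)))
        + 4 * ((3 * w\<^sup>2 * wx * wy + w ^ 3 * wxy) * Im (ux * cnj uy)
        + w ^ 3 * wy * (Im (uxx * cnj uy) + Im (ux * cnj uxy))))
      + (4 * w ^ 3 * wy * (a * Im (u * cnj uy) - Im (ux * cnj uxy))
        + w ^ 4 * (a * (Im (uy * cnj uy) + Im (u * cnj uyy)) - (Im (uxy * cnj uxy) + Im (ux * cnj uxyy))))"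
  unfolding cross_divergence_def A_def B_def by (simp add: algebra_simps)

lemma gradient_divergence_eq:
  fixes u ux uy uxx uyy :: complex and w wx wy a b :: real
  shows "gradient_divergence w wx wy a b u ux uy (uxx + a * u) (uyy + b * u) =
      (2 * w * wx * Re (ux * cnj u) + w\<^sup>2 * (Re (uxx * cnj u) + Re (ux * cnj ux)))
      + (2 * w * wy * Re (uy * cnj u) + w\<^sup>2 * (Re (uyy * cnj u) + Re (uy * cnj uy)))"
  unfolding gradient_divergence_def cmod_power2 by (simp add: algebra_simps power2_eq_square)

lemma integrable_on_sq:
  fixes f :: "real \<times> real \<Rightarrow> real"
  assumes "continuous_on (sq x y s) f"
  shows "f integrable_on sq x y s"
  using assms unfolding sq_def by (rule integrable_continuous)

text \<open>
  The pointwise inequality integrated over a square; the divergences drop out because the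
  cutoff vanishes on the boundary.
\<close>

lemma weighted_energy:
  fixes U :: "nat \<Rightarrow> nat \<Rightarrow> real \<times> real \<Rightarrow> complex" and a b s x y :: real
  assumes s: "s > 0" and ab: "0 \<le> b" "b \<le> a" "1 \<le> a"
    and U: "jet_on \<Omega> U" and sub: "sq x y s \<subseteq> \<Omega>"
  defines "k \<equiv> 2 / s"
  defines "K \<equiv> 192 * k\<^sup>2 * (4 * k\<^sup>2 + 2 + 2 * (192 * k\<^sup>2))"
  defines "A \<equiv> \<lambda>z. U 2 0 z + a * U 0 0 z" and "B \<equiv> \<lambda>z. U 0 2 z + b * U 0 0 z"
  defines "w \<equiv> \<lambda>z. (1 - ((fst z - x) / s)\<^sup>2) * (1 - ((snd z - y) / s)\<^sup>2)"
  shows "integral (sq x y s) (\<lambda>z. w z ^ 4 * ((cmod (A z))\<^sup>2 + (cmod (B z))\<^sup>2) / 4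
            + 48 * k\<^sup>2 * ((w z)\<^sup>2 * ((cmod (U 1 0 z))\<^sup>2 + (cmod (U 0 1 z))\<^sup>2)))
    \<le> integral (sq x y s) (\<lambda>z. (cmod (A z + \<i> * B z))\<^sup>2)
      + K * (a * integral (sq x y s) (\<lambda>z. (cmod (U 0 0 z))\<^sup>2))"
proof -
  let ?Q = "sq x y s"
  define P where "P = (\<lambda>c t. 1 - ((t - c) / s)\<^sup>2)"
  define P' where "P' = (\<lambda>c t. - (2 * (t - c) / s\<^sup>2))"
  have w_eq: "w = (\<lambda>z. P x (fst z) * P y (snd z))" by (simp add: w_def P_def)
  define wx where "wx = (\<lambda>z. P' x (fst z) * P y (snd z))"
  define wy where "wy = (\<lambda>z. P x (fst z) * P' y (snd z))"
  define wxy where "wxy = (\<lambda>z. P' x (fst z) * P' y (snd z))"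
  have DP: "(P c has_real_derivative P' c t) (at t)" for c t
    unfolding P_def P'_def using s
    by (auto intro!: derivative_eq_intros simp: field_simps power2_eq_square)
  have Pb: "0 \<le> P c t" "P c t \<le> 1" "\<bar>P' c t\<bar> \<le> k" if "t \<in> {c - s..c + s}" for c t
    using cutoff_bounds[OF s that] by (auto simp: P_def P'_def k_def)
  have k: "k > 0" using s by (simp add: k_def)
  have wb: "0 \<le> w z" "w z \<le> 1" "\<bar>wx z\<bar> \<le> k" "\<bar>wy z\<bar> \<le> k" "\<bar>wxy z\<bar> \<le> k\<^sup>2" if "z \<in> ?Q" for z
  proof -
    obtain p q where z: "z = (p, q)" by force
    have p: "p \<in> {x - s..x + s}" and q: "q \<in> {y - s..y + s}" using that by (auto simp: z mem_sq)
    show "0 \<le> w z" "w z \<le> 1"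
      using Pb[OF p] Pb[OF q] by (auto simp: w_eq z intro: mult_le_one)
    have "\<bar>wx z\<bar> \<le> k * 1" "\<bar>wy z\<bar> \<le> 1 * k" "\<bar>wxy z\<bar> \<le> k * k"
      unfolding wx_def wy_def wxy_def z abs_mult fst_conv snd_conv
      using Pb[OF p] Pb[OF q] k by (intro mult_mono; simp)+
    then show "\<bar>wx z\<bar> \<le> k" "\<bar>wy z\<bar> \<le> k" "\<bar>wxy z\<bar> \<le> k\<^sup>2" by (simp_all add: power2_eq_square)
  qed
  note cU = jet_on_cont[OF U sub]
  have cP: "continuous_on S (\<lambda>z. P c (f z))" "continuous_on S (\<lambda>z. P' c (f z))"
    if "continuous_on S f" for S c and f :: "real \<times> real \<Rightarrow> real"
    unfolding P_def P'_def using s that by (auto intro!: continuous_intros)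
  have cw: "continuous_on ?Q w" "continuous_on ?Q wx" "continuous_on ?Q wy" "continuous_on ?Q wxy"
    unfolding w_eq wx_def wy_def wxy_def by (intro continuous_intros cP)+
  have cAB: "continuous_on ?Q A" "continuous_on ?Q B"
    unfolding A_def B_def by (intro continuous_intros cU)+
  have Dx_w: "((\<lambda>t. w (t, q)) has_real_derivative wx (p, q)) (at p)"
    "((\<lambda>t. wy (t, q)) has_real_derivative wxy (p, q)) (at p)" for p q
    unfolding w_eq wx_def wy_def wxy_def fst_conv snd_conv using DP
    by (auto intro!: DERIV_cmult_right)
  have Dy_w: "((\<lambda>t. w (p, t)) has_real_derivative wy (p, q)) (at q)" for p q
    unfolding w_eq wy_def fst_conv snd_conv using DP
    by (auto intro!: DERIV_cmult)
  have bd: "w (x - s, q) = 0" "w (x + s, q) = 0" "w (p, y - s) = 0" "w (p, y + s) = 0" for p q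
    using s by (simp_all add: w_def)
  note dU = jet_on_dx[OF U, where S = UNIV] jet_on_dy[OF U, where S = UNIV]
  have Dx: "((\<lambda>t. U i j (t, q)) has_vector_derivative U (Suc i) j (p, q)) (at p)"
    and Dy: "((\<lambda>t. U i j (p, t)) has_vector_derivative U i (Suc j) (p, q)) (at q)"
    if "(p, q) \<in> ?Q" for i j p q
    using dU sub that by auto
  have DxB: "((\<lambda>t. B (t, q)) has_vector_derivative U 1 2 (p, q) + b * U 1 0 (p, q)) (at p)"
    if "(p, q) \<in> ?Q" for p q
    unfolding B_def using Dx[OF that, of 0 2] Dx[OF that, of 0 0]
    by (auto intro!: derivative_eq_intros)
  define h1x where "h1x = (\<lambda>z. w z ^ 4 * Im (U 1 0 z * cnj (B z))
      + 4 * (w z ^ 3 * wy z * Im (U 1 0 z * cnj (U 0 1 z))))"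
  define h1x' where "h1x' = (\<lambda>z. 4 * w z ^ 3 * wx z * Im (U 1 0 z * cnj (B z))
      + w z ^ 4 * (Im (U 2 0 z * cnj (B z)) + Im (U 1 0 z * cnj (U 1 2 z + b * U 1 0 z)))
      + 4 * ((3 * (w z)\<^sup>2 * wx z * wy z + w z ^ 3 * wxy z) * Im (U 1 0 z * cnj (U 0 1 z))
        + w z ^ 3 * wy z * (Im (U 2 0 z * cnj (U 0 1 z)) + Im (U 1 0 z * cnj (U 1 1 z)))))"
  define h1y where "h1y = (\<lambda>z. w z ^ 4 * (a * Im (U 0 0 z * cnj (U 0 1 z)) - Im (U 1 0 z * cnj (U 1 1 z))))"
  define h1y' where "h1y' = (\<lambda>z. 4 * w z ^ 3 * wy z * (a * Im (U 0 0 z * cnj (U 0 1 z)) - Im (U 1 0 z * cnj (U 1 1 z)))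
      + w z ^ 4 * (a * (Im (U 0 1 z * cnj (U 0 1 z)) + Im (U 0 0 z * cnj (U 0 2 z)))
          - (Im (U 1 1 z * cnj (U 1 1 z)) + Im (U 1 0 z * cnj (U 1 2 z)))))"
  define h2x where "h2x = (\<lambda>z. (w z)\<^sup>2 * Re (U 1 0 z * cnj (U 0 0 z)))"
  define h2x' where "h2x' = (\<lambda>z. 2 * w z * wx z * Re (U 1 0 z * cnj (U 0 0 z))
      + (w z)\<^sup>2 * (Re (U 2 0 z * cnj (U 0 0 z)) + Re (U 1 0 z * cnj (U 1 0 z))))"
  define h2y where "h2y = (\<lambda>z. (w z)\<^sup>2 * Re (U 0 1 z * cnj (U 0 0 z)))"
  define h2y' where "h2y' = (\<lambda>z. 2 * w z * wy z * Re (U 0 1 z * cnj (U 0 0 z))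
      + (w z)\<^sup>2 * (Re (U 0 2 z * cnj (U 0 0 z)) + Re (U 0 1 z * cnj (U 0 1 z))))"
  have "(h1x' has_integral 0) ?Q"
  proof (rule integral_dx_eq_0[where h = h1x])
    fix p q assume z: "(p, q) \<in> ?Q"
    note D = DERIV_add[OF DERIV_mult[OF DERIV_power[OF Dx_w(1)[where p = p and q = q], of 4] has_derivative_mult_cnj(1)[OF Dx[OF z, of 1 0] DxB[OF z]]]
        DERIV_cmult[OF DERIV_mult[OF DERIV_mult[OF DERIV_power[OF Dx_w(1)[where p = p and q = q], of 3] Dx_w(2)[where p = p and q = q]] has_derivative_mult_cnj(1)[OF Dx[OF z, of 1 0] Dx[OF z, of 0 1]]], where c = 4]]
    show "((\<lambda>t. h1x (t, q)) has_real_derivative h1x' (p, q)) (at p)"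
      unfolding h1x_def h1x'_def by (rule DERIV_cong[OF D]) (simp add: numeral_2_eq_2 algebra_simps)
  qed (auto simp: s h1x_def bd h1x'_def intro!: continuous_intros cU cw cAB)
  moreover have "(h1y' has_integral 0) ?Q"
  proof (rule integral_dy_eq_0[where h = h1y])
    fix p q assume z: "(p, q) \<in> ?Q"
    note D = DERIV_mult[OF DERIV_power[OF Dy_w[where p = p and q = q], of 4] DERIV_diff[OF DERIV_cmult[OF has_derivative_mult_cnj(1)[OF Dy[OF z, of 0 0] Dy[OF z, of 0 1]], where c = a]
        has_derivative_mult_cnj(1)[OF Dy[OF z, of 1 0] Dy[OF z, of 1 1]]]]
    show "((\<lambda>t. h1y (p, t)) has_real_derivative h1y' (p, q)) (at q)"
      unfolding h1y_def h1y'_def by (rule DERIV_cong[OF D]) (simp add: numeral_2_eq_2 algebra_simps)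
  qed (auto simp: s h1y_def bd h1y'_def intro!: continuous_intros cU cw cAB)
  moreover have "(h2x' has_integral 0) ?Q"
  proof (rule integral_dx_eq_0[where h = h2x])
    fix p q assume z: "(p, q) \<in> ?Q"
    note D = DERIV_mult[OF DERIV_power[OF Dx_w(1)[where p = p and q = q], of 2] has_derivative_mult_cnj(2)[OF Dx[OF z, of 1 0] Dx[OF z, of 0 0]]]
    show "((\<lambda>t. h2x (t, q)) has_real_derivative h2x' (p, q)) (at p)"
      unfolding h2x_def h2x'_def by (rule DERIV_cong[OF D]) (simp add: numeral_2_eq_2 algebra_simps)
  qed (auto simp: s h2x_def bd h2x'_def intro!: continuous_intros cU cw cAB)
  moreover have "(h2y' has_integral 0) ?Q"
  proof (rule integral_dy_eq_0[where h = h2y])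
    fix p q assume z: "(p, q) \<in> ?Q"
    note D = DERIV_mult[OF DERIV_power[OF Dy_w[where p = p and q = q], of 2] has_derivative_mult_cnj(2)[OF Dy[OF z, of 0 1] Dy[OF z, of 0 0]]]
    show "((\<lambda>t. h2y (p, t)) has_real_derivative h2y' (p, q)) (at q)"
      unfolding h2y_def h2y'_def by (rule DERIV_cong[OF D]) (simp add: numeral_2_eq_2 algebra_simps)
  qed (auto simp: s h2y_def bd h2y'_def intro!: continuous_intros cU cw cAB)
  ultimately have "((\<lambda>z. 192 * k\<^sup>2 * (h2x' z + h2y' z) - 2 * (h1x' z + h1y' z)) has_integral
      192 * k\<^sup>2 * (0 + 0) - 2 * (0 + 0)) ?Q"
    by (intro has_integral_diff has_integral_add has_integral_mult_right)
  then have div: "((\<lambda>z. 192 * k\<^sup>2 * (h2x' z + h2y' z) - 2 * (h1x' z + h1y' z)) has_integral 0) ?Q"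
    by simp
  have "((\<lambda>z. (cmod (A z + \<i> * B z))\<^sup>2) has_integral integral ?Q (\<lambda>z. (cmod (A z + \<i> * B z))\<^sup>2)) ?Q"
    "((\<lambda>z. (cmod (U 0 0 z))\<^sup>2) has_integral integral ?Q (\<lambda>z. (cmod (U 0 0 z))\<^sup>2)) ?Q"
    by (intro integrable_integral integrable_on_sq continuous_intros cAB cU)+
  then have R: "((\<lambda>z. (cmod (A z + \<i> * B z))\<^sup>2 + K * (a * (cmod (U 0 0 z))\<^sup>2)
      + (192 * k\<^sup>2 * (h2x' z + h2y' z) - 2 * (h1x' z + h1y' z))) has_integral
      integral ?Q (\<lambda>z. (cmod (A z + \<i> * B z))\<^sup>2) + K * (a * integral ?Q (\<lambda>z. (cmod (U 0 0 z))\<^sup>2)) + 0) ?Q"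
    by (intro has_integral_add has_integral_mult_right div)
  have L: "(\<lambda>z. w z ^ 4 * ((cmod (A z))\<^sup>2 + (cmod (B z))\<^sup>2) / 4
            + 48 * k\<^sup>2 * ((w z)\<^sup>2 * ((cmod (U 1 0 z))\<^sup>2 + (cmod (U 0 1 z))\<^sup>2))) integrable_on ?Q"
    by (intro integrable_on_sq continuous_intros cAB cU cw) simp
  have "w z ^ 4 * ((cmod (A z))\<^sup>2 + (cmod (B z))\<^sup>2) / 4
            + 48 * k\<^sup>2 * ((w z)\<^sup>2 * ((cmod (U 1 0 z))\<^sup>2 + (cmod (U 0 1 z))\<^sup>2))
    \<le> (cmod (A z + \<i> * B z))\<^sup>2 + K * (a * (cmod (U 0 0 z))\<^sup>2)
      + (192 * k\<^sup>2 * (h2x' z + h2y' z) - 2 * (h1x' z + h1y' z))" if z: "z \<in> ?Q" for z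
  proof -
    have "h1x' z + h1y' z = cross_divergence (w z) (wx z) (wy z) (wxy z) (U 1 0 z) (U 0 1 z) (A z) (B z)"
      unfolding A_def B_def cross_divergence_eq[where uxy = "U 1 1 z" and uxyy = "U 1 2 z"] h1x'_def h1y'_def by simp
    moreover have "h2x' z + h2y' z = gradient_divergence (w z) (wx z) (wy z) a b (U 0 0 z) (U 1 0 z) (U 0 1 z) (A z) (B z)"
      unfolding A_def B_def gradient_divergence_eq h2x'_def h2y'_def by simp
    ultimately show ?thesis
      using pointwise_energy[OF wb[OF z] k ab, of "A z" "B z" "U 1 0 z" "U 0 1 z" "U 0 0 z"]
      by (simp only: K_def)
  qed
  from has_integral_le[OF integrable_integral[OF L] R this] show ?thesis by simp
qed

text \<open>
  On the concentric square of half the size the cutoff is bounded below. The point is the power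
  of \<open>a\<close>: if \<open>u\<close> and \<open>A + \<i> B\<close> are \<open>O(1)\<close> in mean square, then each of \<open>A\<close>, \<open>B\<close> and the gradient is
  \<open>O(sqrt a)\<close> in mean square, although \<open>A\<close> and \<open>B\<close> contain the terms \<open>a u\<close> and \<open>b u\<close>.
\<close>

lemma interior_estimate:
  fixes s :: real
  assumes s: "s > 0"
  obtains C :: real where "C > 0"
    and "\<And>\<Omega> U x y a b. jet_on \<Omega> U \<Longrightarrow> sq x y s \<subseteq> \<Omega> \<Longrightarrow> 0 \<le> b \<Longrightarrow> b \<le> a \<Longrightarrow> 1 \<le> a \<Longrightarrow>
      integral (sq x y (s / 2)) (\<lambda>z. (cmod (U 2 0 z + complex_of_real a * U 0 0 z))\<^sup>2 + (cmod (U 0 2 z + complex_of_real b * U 0 0 z))\<^sup>2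
          + (cmod (U 1 0 z))\<^sup>2 + (cmod (U 0 1 z))\<^sup>2)
      \<le> C * (integral (sq x y s) (\<lambda>z. (cmod (U 2 0 z + complex_of_real a * U 0 0 z + \<i> * (U 0 2 z + complex_of_real b * U 0 0 z)))\<^sup>2)
            + a * integral (sq x y s) (\<lambda>z. (cmod (U 0 0 z))\<^sup>2))"
proof -
  define k where "k = 2 / s"
  define K where "K = 192 * k\<^sup>2 * (4 * k\<^sup>2 + 2 + 2 * (192 * k\<^sup>2))"
  define \<delta> where "\<delta> = min (1 / 40) (14 * k\<^sup>2)"
  have k: "k > 0" using s by (simp add: k_def)
  then have \<delta>: "\<delta> > 0" by (simp add: \<delta>_def)
  show thesis
  proof (rule that[of "max 1 K / \<delta>"])
    fix \<Omega> :: "(real \<times> real) set" and U x y and a b :: real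
    assume U: "jet_on \<Omega> U" and sub: "sq x y s \<subseteq> \<Omega>" and ab: "0 \<le> b" "b \<le> a" "1 \<le> a"
    let ?Q = "sq x y s" and ?H = "sq x y (s / 2)"
    define A where "A = (\<lambda>z. U 2 0 z + a * U 0 0 z)"
    define B where "B = (\<lambda>z. U 0 2 z + b * U 0 0 z)"
    define w where "w = (\<lambda>z. (1 - ((fst z - x) / s)\<^sup>2) * (1 - ((snd z - y) / s)\<^sup>2))"
    define L where "L = (\<lambda>z. w z ^ 4 * ((cmod (A z))\<^sup>2 + (cmod (B z))\<^sup>2) / 4
            + 48 * k\<^sup>2 * ((w z)\<^sup>2 * ((cmod (U 1 0 z))\<^sup>2 + (cmod (U 0 1 z))\<^sup>2)))"
    define l where "l = (\<lambda>z. (cmod (A z))\<^sup>2 + (cmod (B z))\<^sup>2 + (cmod (U 1 0 z))\<^sup>2 + (cmod (U 0 1 z))\<^sup>2)"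
    define G where "G = integral ?Q (\<lambda>z. (cmod (A z + \<i> * B z))\<^sup>2)"
    define N where "N = integral ?Q (\<lambda>z. (cmod (U 0 0 z))\<^sup>2)"
    note cU = jet_on_cont[OF U sub]
    have HQ: "?H \<subseteq> ?Q" using s by (intro sq_mono) simp
    have cAB: "continuous_on ?Q A" "continuous_on ?Q B"
      unfolding A_def B_def by (intro continuous_intros cU)+
    have cw: "continuous_on ?Q w"
      unfolding w_def using s by (intro continuous_intros) auto
    have cl: "continuous_on ?Q l" and cL: "continuous_on ?Q L"
      unfolding l_def L_def by (intro continuous_intros cAB cU cw; simp)+
    have GN: "G \<ge> 0" "N \<ge> 0"
      unfolding G_def N_def by (intro integral_nonneg integrable_on_sq continuous_intros cAB cU; simp)+
    have pt: "\<delta> * l z \<le> L z" if "z \<in> ?H" for z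
    proof -
      obtain p q where z: "z = (p, q)" by force
      have P: "3 / 4 \<le> 1 - ((t - c) / s)\<^sup>2" if "t \<in> {c - s / 2..c + s / 2}" for c t
      proof -
        have "\<bar>t - c\<bar> \<le> s / 2" using that unfolding atLeastAtMost_iff by linarith
        then have "\<bar>(t - c) / s\<bar> \<le> 1 / 2" using s by (simp add: field_simps)
        then have "\<bar>(t - c) / s\<bar>\<^sup>2 \<le> (1 / 2)\<^sup>2" by (intro power_mono) auto
        then show ?thesis by (simp add: power2_eq_square)
      qed
      have "3 / 4 * (3 / 4) \<le> w z"
        unfolding w_def using P[of p x] P[of q y] that
        by (intro mult_mono) (auto simp: z mem_sq)
      then have w: "9 / 16 \<le> w z" by simp
      have "(9 / 16) ^ 4 \<le> w z ^ 4" "(9 / 16)\<^sup>2 \<le> (w z)\<^sup>2" using w by (intro power_mono; simp)+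
      then have w': "1 / 10 \<le> w z ^ 4" "3 / 10 \<le> (w z)\<^sup>2" by (simp_all add: power_divide)
      have "\<delta> * ((cmod (A z))\<^sup>2 + (cmod (B z))\<^sup>2) \<le> w z ^ 4 / 4 * ((cmod (A z))\<^sup>2 + (cmod (B z))\<^sup>2)"
        using w' by (intro mult_right_mono) (auto simp: \<delta>_def)
      moreover have "\<delta> * ((cmod (U 1 0 z))\<^sup>2 + (cmod (U 0 1 z))\<^sup>2)
          \<le> 48 * k\<^sup>2 * (w z)\<^sup>2 * ((cmod (U 1 0 z))\<^sup>2 + (cmod (U 0 1 z))\<^sup>2)"
      proof (intro mult_right_mono)
        have "\<delta> \<le> 48 * k\<^sup>2 * (3 / 10)" by (simp add: \<delta>_def min_def)
        also have "\<dots> \<le> 48 * k\<^sup>2 * (w z)\<^sup>2" using w' by (intro mult_left_mono) auto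
        finally show "\<delta> \<le> 48 * k\<^sup>2 * (w z)\<^sup>2" .
      qed simp
      ultimately show ?thesis by (simp add: l_def L_def distrib_left add_divide_distrib mult.assoc)
    qed
    have "\<delta> * integral ?H l = integral ?H (\<lambda>z. \<delta> * l z)" by simp
    also have "\<dots> \<le> integral ?H L"
      using pt HQ continuous_on_subset[OF cl HQ] continuous_on_subset[OF cL HQ]
      by (intro integral_le integrable_on_sq continuous_intros) auto
    also have "\<dots> \<le> integral ?Q L"
      using HQ continuous_on_subset[OF cL HQ] cL
      by (intro integral_subset_le integrable_on_sq) (auto simp: L_def)
    also have "\<dots> \<le> G + K * (a * N)"
      using weighted_energy[OF s ab U sub]
      unfolding L_def G_def N_def K_def k_def A_def B_def w_def .
    also have "\<dots> \<le> max 1 K * G + max 1 K * (a * N)"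
      using GN ab mult_right_mono[of 1 "max 1 K" G] by (intro add_mono mult_right_mono) auto
    finally have "integral ?H l \<le> max 1 K / \<delta> * (G + a * N)"
      using \<delta> by (simp add: field_simps)
    then show "integral ?H (\<lambda>z. (cmod (U 2 0 z + complex_of_real a * U 0 0 z))\<^sup>2 + (cmod (U 0 2 z + complex_of_real b * U 0 0 z))\<^sup>2
          + (cmod (U 1 0 z))\<^sup>2 + (cmod (U 0 1 z))\<^sup>2)
      \<le> max 1 K / \<delta> * (integral ?Q (\<lambda>z. (cmod (U 2 0 z + complex_of_real a * U 0 0 z + \<i> * (U 0 2 z + complex_of_real b * U 0 0 z)))\<^sup>2)
            + a * integral ?Q (\<lambda>z. (cmod (U 0 0 z))\<^sup>2))"
      unfolding l_def A_def B_def G_def N_def .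
  qed (use \<delta> in auto)
qed

section \<open>From energy to pointwise values\<close>

lemma sq_slice_integrable:
  fixes f :: "real \<times> real \<Rightarrow> real"
  assumes "continuous_on (sq x y s) f"
  shows "(\<lambda>q. integral {x - s..x + s} (\<lambda>p. f (p, q))) integrable_on {y - s..y + s}"
proof -
  have "continuous_on (cbox (y - s, x - s) (y + s, x + s)) (\<lambda>z. f (snd z, fst z))"
    by (rule continuous_on_compose2[OF assms])
       (auto intro!: continuous_intros simp: sq_def cbox_Pair_eq)
  from integral_integrable_2dim[OF this] show ?thesis by simp
qed

text \<open>
  The one-dimensional bound with \<open>\<kappa> = sqrt a\<close> on every horizontal line, integrated over the lines.
  A forcing of size \<open>O(sqrt a)\<close> is what the factor \<open>s / a\<close> tolerates.
\<close>

lemma center_line_bound: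
  fixes U :: "nat \<Rightarrow> nat \<Rightarrow> real \<times> real \<Rightarrow> complex" and a s x y :: real
  assumes s: "s > 0" and a: "1 \<le> a" and U: "jet_on \<Omega> U" and sub: "sq x y s \<subseteq> \<Omega>"
  shows "integral {y - s..y + s} (\<lambda>q. (cmod (U 0 0 (x, q)))\<^sup>2) \<le> 139 * (max 1 (1 / s))\<^sup>2 *
      (1 / s * integral (sq x y s) (\<lambda>z. (cmod (U 0 0 z))\<^sup>2)
       + s / a * integral (sq x y s) (\<lambda>z. (cmod (U 2 0 z + complex_of_real a * U 0 0 z))\<^sup>2))"
proof -
  let ?I = "{x - s..x + s}" and ?J = "{y - s..y + s}"
  define c where "c = 139 * (max 1 (1 / s))\<^sup>2"
  define F where "F = (\<lambda>z. (cmod (U 0 0 z))\<^sup>2)"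
  define G where "G = (\<lambda>z. (cmod (U 2 0 z + complex_of_real a * U 0 0 z))\<^sup>2)"
  note cU = jet_on_cont[OF U sub]
  have cF: "continuous_on (sq x y s) F" and cG: "continuous_on (sq x y s) G"
    unfolding F_def G_def by (intro continuous_intros cU)+
  have xline: "continuous_on ?I (\<lambda>p. f (p, q))" if "continuous_on (sq x y s) f" "q \<in> ?J"
    for q and f :: "real \<times> real \<Rightarrow> complex"
    by (rule continuous_on_compose2[OF that(1)]) (use that(2) in \<open>auto intro!: continuous_intros simp: mem_sq\<close>)
  have cline: "continuous_on ?J (\<lambda>q. F (x, q))"
    by (rule continuous_on_compose2[OF cF]) (use s in \<open>auto intro!: continuous_intros simp: mem_sq\<close>)
  have pt: "F (x, q) \<le> c * (1 / s * integral ?I (\<lambda>p. F (p, q)) + s / a * integral ?I (\<lambda>p. G (p, q)))"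
    if q: "q \<in> ?J" for q
  proof -
    have mem: "(p, q) \<in> \<Omega>" if "p \<in> ?I" for p using sub that q by (auto simp: mem_sq)
    have "(sqrt a)\<^sup>2 * (cmod (U 0 0 (x, q)))\<^sup>2 \<le> 139 * (max 1 (1 / s))\<^sup>2 *
      ((sqrt a)\<^sup>2 / s * integral ?I (\<lambda>p. (cmod (U 0 0 (p, q)))\<^sup>2)
        + s * integral ?I (\<lambda>p. (cmod (U 2 0 (p, q) + complex_of_real ((sqrt a)\<^sup>2) * U 0 0 (p, q)))\<^sup>2))"
    proof (rule interval_bound)
      have "1 / s \<le> max 1 (1 / s) * 1" by simp
      also have "\<dots> \<le> max 1 (1 / s) * sqrt a" using a by (intro mult_left_mono) auto
      finally show "1 / s \<le> max 1 (1 / s) * sqrt a" .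
    next
      show "((\<lambda>p. U 0 0 (p, q)) has_vector_derivative U 1 0 (t, q)) (at t within ?I)" if "t \<in> ?I" for t
        using jet_on_dx[OF U mem[OF that], of 0 0] by simp
      show "((\<lambda>p. U 1 0 (p, q)) has_vector_derivative U 2 0 (t, q)) (at t within ?I)" if "t \<in> ?I" for t
        using jet_on_dx[OF U mem[OF that], of 1 0] by (simp add: numeral_2_eq_2)
    qed (use s a xline[OF cU q] in auto)
    then have "a * F (x, q) \<le> c * (a / s * integral ?I (\<lambda>p. F (p, q)) + s * integral ?I (\<lambda>p. G (p, q)))"
      using a by (simp add: F_def G_def c_def)
    then have "F (x, q) \<le> c * (a / s * integral ?I (\<lambda>p. F (p, q)) + s * integral ?I (\<lambda>p. G (p, q))) / a"
      using a by (simp add: field_simps)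
    also have "\<dots> = c * (1 / s * integral ?I (\<lambda>p. F (p, q)) + s / a * integral ?I (\<lambda>p. G (p, q)))"
      using a s by (simp add: field_simps)
    finally show ?thesis .
  qed
  have "integral ?J (\<lambda>q. F (x, q)) \<le>
      integral ?J (\<lambda>q. c * (1 / s * integral ?I (\<lambda>p. F (p, q)) + s / a * integral ?I (\<lambda>p. G (p, q))))"
    by (rule integral_le[OF integrable_continuous_real[OF cline] _ pt])
       (intro integrable_on_mult_right integrable_add sq_slice_integrable cF cG)
  also have "\<dots> = c * (1 / s * integral (sq x y s) F + s / a * integral (sq x y s) G)"
    unfolding sq_iterated_integrals(2)[OF cF] sq_iterated_integrals(2)[OF cG]
    by (intro integral_unique has_integral_mult_right has_integral_add integrable_integral
        sq_slice_integrable cF cG)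
  finally show ?thesis unfolding F_def G_def c_def .
qed

lemma jet_on_shift:
  assumes "jet_on \<Omega> U"
  shows "jet_on \<Omega> (\<lambda>i j z. U i (j + 2) z + complex_of_real b * U i j z)"
  unfolding jet_on_def
proof (intro conjI allI impI)
  fix i j and x y :: real
  assume z: "(x, y) \<in> \<Omega>"
  show "((\<lambda>t. U i (j + 2) (t, y) + complex_of_real b * U i j (t, y)) has_vector_derivative
      U (Suc i) (j + 2) (x, y) + complex_of_real b * U (Suc i) j (x, y)) (at x)"
    by (intro has_vector_derivative_add has_vector_derivative_mult_right jet_on_dx[OF assms z])
  show "((\<lambda>t. U i (j + 2) (x, t) + complex_of_real b * U i j (x, t)) has_vector_derivative
      U i (Suc j + 2) (x, y) + complex_of_real b * U i (Suc j) (x, y)) (at y)"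
    using jet_on_dy[OF assms z, of i "j + 2"]
    by (intro has_vector_derivative_add has_vector_derivative_mult_right jet_on_dy[OF assms z]) auto
qed (intro continuous_intros jet_on_cont[OF assms order_refl])

lemma dy_unique_on:
  fixes f g :: "real \<times> real \<Rightarrow> complex"
  assumes "open \<Omega>" "(x, y) \<in> \<Omega>" "\<And>z. z \<in> \<Omega> \<Longrightarrow> f z = g z"
    and f: "((\<lambda>t. f (x, t)) has_vector_derivative f') (at y)"
    and g: "((\<lambda>t. g (x, t)) has_vector_derivative g') (at y)"
  shows "f' = g'"
proof -
  have "open ((\<lambda>t. (x, t)) -` \<Omega>)"
    using assms(1) by (intro open_vimage continuous_intros)
  then have "((\<lambda>t. g (x, t)) has_vector_derivative f') (at y)"
    by (rule has_vector_derivative_transform_within_open[OF f]) (use assms in auto)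
  then show ?thesis using g by (rule vector_derivative_unique_at)
qed

text \<open>
  The equation is needed for \<open>U 0 2\<close> as well. The derivatives in \<open>x\<close> that occur are already derivatives
  of the family, hence only the product on the right produces new terms.
\<close>

lemma eigenvalue_equation_dyy:
  fixes U V :: "nat \<Rightarrow> nat \<Rightarrow> real \<times> real \<Rightarrow> complex" and l :: complex
  assumes \<Omega>: "open \<Omega>" and U: "jet_on \<Omega> U" and V: "jet_on \<Omega> V"
    and eq: "\<And>z. z \<in> \<Omega> \<Longrightarrow> U 2 0 z + \<i> * U 0 2 z + l * U 0 0 z = V 0 0 z * U 0 0 z"
    and z: "z \<in> \<Omega>"
  shows "U 2 2 z + \<i> * U 0 4 z + l * U 0 2 z = V 0 2 z * U 0 0 z + 2 * V 0 1 z * U 0 1 z + V 0 0 z * U 0 2 z"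
proof -
  have L: "((\<lambda>t. U 2 j (x, t) + \<i> * U 0 (j + 2) (x, t) + l * U 0 j (x, t)) has_vector_derivative
      U 2 (Suc j) (x, y) + \<i> * U 0 (Suc j + 2) (x, y) + l * U 0 (Suc j) (x, y)) (at y)"
    if "(x, y) \<in> \<Omega>" for j x y
    using jet_on_dy[OF U that, of 0 "j + 2"]
    by (intro has_vector_derivative_add has_vector_derivative_mult_right jet_on_dy[OF U that]) auto
  have R: "((\<lambda>t. V 0 i (x, t) * U 0 j (x, t)) has_vector_derivative
      V 0 i (x, y) * U 0 (Suc j) (x, y) + V 0 (Suc i) (x, y) * U 0 j (x, y)) (at y)"
    if "(x, y) \<in> \<Omega>" for i j x y
    by (intro has_vector_derivative_mult jet_on_dy[OF U that] jet_on_dy[OF V that])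
  have 1: "U 2 1 z + \<i> * U 0 3 z + l * U 0 1 z = V 0 0 z * U 0 1 z + V 0 1 z * U 0 0 z"
    if "z \<in> \<Omega>" for z
  proof -
    obtain x y where z: "z = (x, y)" by force
    show ?thesis
      unfolding z
    proof (rule dy_unique_on[where f = "\<lambda>z. U 2 0 z + \<i> * U 0 2 z + l * U 0 0 z" and g = "\<lambda>z. V 0 0 z * U 0 0 z"])
      show "((\<lambda>t. U 2 0 (x, t) + \<i> * U 0 2 (x, t) + l * U 0 0 (x, t)) has_vector_derivative
          U 2 1 (x, y) + \<i> * U 0 3 (x, y) + l * U 0 1 (x, y)) (at y)"
        using L[of x y 0] that by (simp add: z numeral_eq_Suc)
      show "((\<lambda>t. V 0 0 (x, t) * U 0 0 (x, t)) has_vector_derivative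
          V 0 0 (x, y) * U 0 1 (x, y) + V 0 1 (x, y) * U 0 0 (x, y)) (at y)"
        using R[of x y 0 0] that by (simp add: z)
    qed (use \<Omega> that eq in \<open>auto simp: z\<close>)
  qed
  obtain x y where xy: "z = (x, y)" by force
  have "U 2 2 (x, y) + \<i> * U 0 4 (x, y) + l * U 0 2 (x, y)
      = (V 0 0 (x, y) * U 0 2 (x, y) + V 0 1 (x, y) * U 0 1 (x, y))
        + (V 0 1 (x, y) * U 0 1 (x, y) + V 0 2 (x, y) * U 0 0 (x, y))"
  proof (rule dy_unique_on[where f = "\<lambda>z. U 2 1 z + \<i> * U 0 3 z + l * U 0 1 z"
        and g = "\<lambda>z. V 0 0 z * U 0 1 z + V 0 1 z * U 0 0 z"])
    show "((\<lambda>t. U 2 1 (x, t) + \<i> * U 0 3 (x, t) + l * U 0 1 (x, t)) has_vector_derivative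
        U 2 2 (x, y) + \<i> * U 0 4 (x, y) + l * U 0 2 (x, y)) (at y)"
      using L[of x y 1] z by (simp add: xy numeral_eq_Suc)
    show "((\<lambda>t. V 0 0 (x, t) * U 0 1 (x, t) + V 0 1 (x, t) * U 0 0 (x, t)) has_vector_derivative
        (V 0 0 (x, y) * U 0 2 (x, y) + V 0 1 (x, y) * U 0 1 (x, y))
        + (V 0 1 (x, y) * U 0 1 (x, y) + V 0 2 (x, y) * U 0 0 (x, y))) (at y)"
      using has_vector_derivative_add[OF R[of x y 0 1] R[of x y 1 0]] z by (simp add: xy numeral_eq_Suc)
  qed (use \<Omega> z 1 in \<open>auto simp: xy\<close>)
  then show ?thesis by (simp add: xy algebra_simps)
qed

lemma norm_sum3_squared_le:
  fixes a b c :: complex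
  shows "(cmod (a + b + c))\<^sup>2 \<le> 3 * ((cmod a)\<^sup>2 + (cmod b)\<^sup>2 + (cmod c)\<^sup>2)"
proof -
  have "(cmod (a + b + c))\<^sup>2 \<le> (cmod a + cmod b + cmod c)\<^sup>2"
    by (intro power_mono norm_triangle_mono norm_triangle_ineq order_refl norm_ge_zero)
  also have "\<dots> \<le> 3 * ((cmod a)\<^sup>2 + (cmod b)\<^sup>2 + (cmod c)\<^sup>2)"
    using sum_squares_ge_zero[of "cmod a - cmod b" "cmod b - cmod c"] zero_le_power2[of "cmod a - cmod c"]
    by (simp add: power2_eq_square algebra_simps)
  finally show ?thesis .
qed

lemma integral_sq_mono:
  fixes f :: "real \<times> real \<Rightarrow> real"
  assumes "p \<le> q" "continuous_on (sq x y q) f" "\<And>z. f z \<ge> 0"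
  shows "integral (sq x y p) f \<le> integral (sq x y q) f"
  using assms sq_mono[OF assms(1)] continuous_on_subset[OF assms(2) sq_mono[OF assms(1)]]
  by (intro integral_subset_le integrable_on_sq) auto

text \<open>
  The core of the proof, for \<open>Re l = a \<ge> b = Im l\<close>. The interior estimate is applied to \<open>u = U 0 0\<close> and
  then, on a smaller square, to \<open>\<Phi> = u\<^sub>y\<^sub>y + b u\<close>, which solves the same equation up to terms of size
  \<open>O(sqrt a)\<close> and is itself \<open>O(sqrt a)\<close>. Hence \<open>u\<close> is \<open>O(1)\<close> and \<open>\<Phi>\<close> is \<open>O(sqrt a)\<close> in mean square on
  the vertical line through the centre. On that line \<open>u\<close> is an oscillator with forcing \<open>\<Phi>\<close>, and the
  one-dimensional bound applies once more.
\<close>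

lemma jet_eigenfunction_bound:
  fixes s K :: real
  assumes s: "s > 0" and K: "K \<ge> 0"
  obtains C :: real where "C > 0"
    and "\<And>\<Omega> U V x y a b. open \<Omega> \<Longrightarrow> jet_on \<Omega> U \<Longrightarrow> jet_on \<Omega> V \<Longrightarrow> sq x y s \<subseteq> \<Omega> \<Longrightarrow>
      0 \<le> b \<Longrightarrow> b \<le> a \<Longrightarrow> 1 \<le> a \<Longrightarrow>
      (\<And>z. z \<in> \<Omega> \<Longrightarrow> U 2 0 z + \<i> * U 0 2 z + Complex a b * U 0 0 z = V 0 0 z * U 0 0 z) \<Longrightarrow>
      (\<And>z j. z \<in> sq x y s \<Longrightarrow> j \<le> 2 \<Longrightarrow> cmod (V 0 j z) \<le> K) \<Longrightarrow>
      (cmod (U 0 0 (x, y)))\<^sup>2 \<le> C * sqrt (a / max b (sqrt a)) * integral (sq x y s) (\<lambda>z. (cmod (U 0 0 z))\<^sup>2)"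
proof -
  obtain C1 where C1: "C1 > 0" and est1: "\<And>\<Omega> U x y a b. jet_on \<Omega> U \<Longrightarrow> sq x y s \<subseteq> \<Omega> \<Longrightarrow> 0 \<le> b \<Longrightarrow> b \<le> a \<Longrightarrow> 1 \<le> a \<Longrightarrow>
      integral (sq x y (s / 2)) (\<lambda>z. (cmod (U 2 0 z + complex_of_real a * U 0 0 z))\<^sup>2 + (cmod (U 0 2 z + complex_of_real b * U 0 0 z))\<^sup>2
          + (cmod (U 1 0 z))\<^sup>2 + (cmod (U 0 1 z))\<^sup>2)
      \<le> C1 * (integral (sq x y s) (\<lambda>z. (cmod (U 2 0 z + complex_of_real a * U 0 0 z + \<i> * (U 0 2 z + complex_of_real b * U 0 0 z)))\<^sup>2)
            + a * integral (sq x y s) (\<lambda>z. (cmod (U 0 0 z))\<^sup>2))"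
    using interior_estimate[OF s] by blast
  have s2: "s / 2 > 0" using s by simp
  obtain C2 where C2: "C2 > 0" and est2: "\<And>\<Omega> U x y a b. jet_on \<Omega> U \<Longrightarrow> sq x y (s / 2) \<subseteq> \<Omega> \<Longrightarrow> 0 \<le> b \<Longrightarrow> b \<le> a \<Longrightarrow> 1 \<le> a \<Longrightarrow>
      integral (sq x y (s / 2 / 2)) (\<lambda>z. (cmod (U 2 0 z + complex_of_real a * U 0 0 z))\<^sup>2 + (cmod (U 0 2 z + complex_of_real b * U 0 0 z))\<^sup>2
          + (cmod (U 1 0 z))\<^sup>2 + (cmod (U 0 1 z))\<^sup>2)
      \<le> C2 * (integral (sq x y (s / 2)) (\<lambda>z. (cmod (U 2 0 z + complex_of_real a * U 0 0 z + \<i> * (U 0 2 z + complex_of_real b * U 0 0 z)))\<^sup>2)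
            + a * integral (sq x y (s / 2)) (\<lambda>z. (cmod (U 0 0 z))\<^sup>2))"
    using interior_estimate[OF s2] by blast
  define D1 where "D1 = C1 * (K\<^sup>2 + 1)"
  define D2 where "D2 = C2 * (12 * K\<^sup>2 * (1 + D1) + D1)"
  define \<sigma> where "\<sigma> = s / 4"
  define m where "m = max 1 (1 / \<sigma>)"
  define E1 where "E1 = 139 * m\<^sup>2 * (1 / \<sigma> + \<sigma> * D1)"
  define E2 where "E2 = 139 * m\<^sup>2 * (1 / \<sigma> * D1 + \<sigma> * D2)"
  define C where "C = 139 * m\<^sup>2 * (E1 / \<sigma> + \<sigma> * (2 * E1 + 2 * E2))"
  have D: "D1 \<ge> 0" "D2 \<ge> 0" using C1 C2 by (simp_all add: D1_def D2_def)
  have \<sigma>: "\<sigma> > 0" using s by (simp add: \<sigma>_def)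
  have m: "m \<ge> 1" "1 / \<sigma> \<le> m" by (simp_all add: m_def)
  have E: "E1 > 0" "E2 \<ge> 0" using D \<sigma> m(1) by (auto simp: E1_def E2_def intro!: mult_pos_pos add_pos_nonneg)
  show thesis
  proof (rule that[of C])
    show "C > 0" using E \<sigma> m(1) by (auto simp: C_def intro!: mult_pos_pos add_pos_nonneg)
  next
    fix \<Omega> :: "(real \<times> real) set" and U V x y and a b :: real
    assume \<Omega>: "open \<Omega>" and U: "jet_on \<Omega> U" and V: "jet_on \<Omega> V" and sub: "sq x y s \<subseteq> \<Omega>"
      and ab: "0 \<le> b" "b \<le> a" "1 \<le> a"
      and eq: "\<And>z. z \<in> \<Omega> \<Longrightarrow> U 2 0 z + \<i> * U 0 2 z + Complex a b * U 0 0 z = V 0 0 z * U 0 0 z"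
      and VK: "\<And>z j. z \<in> sq x y s \<Longrightarrow> j \<le> 2 \<Longrightarrow> cmod (V 0 j z) \<le> K"
    let ?Q = "sq x y s" and ?H = "sq x y (s / 2)" and ?R = "sq x y \<sigma>"
    define \<Phi> where "\<Phi> = (\<lambda>i j z. U i (j + 2) z + complex_of_real b * U i j z)"
    have \<Phi>: "jet_on \<Omega> \<Phi>" unfolding \<Phi>_def by (rule jet_on_shift[OF U])
    define N where "N = integral ?Q (\<lambda>z. (cmod (U 0 0 z))\<^sup>2)"
    define A where "A = (\<lambda>z. U 2 0 z + complex_of_real a * U 0 0 z)"
    define A\<Phi> where "A\<Phi> = (\<lambda>z. \<Phi> 2 0 z + complex_of_real a * \<Phi> 0 0 z)"
    have HQ: "?H \<subseteq> ?Q" and RH: "?R \<subseteq> ?H" using s by (auto intro!: sq_mono simp: \<sigma>_def)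
    have subH: "?H \<subseteq> \<Omega>" and subR: "?R \<subseteq> \<Omega>" using HQ RH sub by auto
    note cU = jet_on_cont[OF U] and cV = jet_on_cont[OF V] and c\<Phi> = jet_on_cont[OF \<Phi>]
    have cA: "continuous_on S A" "continuous_on S A\<Phi>" if "S \<subseteq> \<Omega>" for S
      unfolding A_def A\<Phi>_def by (intro continuous_intros cU c\<Phi> that)+
    have Cab: "Complex a b = complex_of_real a + \<i> * complex_of_real b"
      by (simp add: complex_eq_iff)
    have eqA: "A z + \<i> * \<Phi> 0 0 z = V 0 0 z * U 0 0 z" if "z \<in> \<Omega>" for z
      using eq[OF that] unfolding A_def \<Phi>_def Cab by (simp add: algebra_simps numeral_2_eq_2)
    \<comment> \<open>The function \<open>g\<^sub>\<Phi> = \<partial>\<^sub>y\<^sub>y (V u) + b V u\<close>, in which the two terms of size \<open>b\<close> combine into \<open>V \<Phi>\<close>.\<close>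
    have eqA\<Phi>: "A\<Phi> z + \<i> * (\<Phi> 0 2 z + complex_of_real b * \<Phi> 0 0 z)
        = V 0 2 z * U 0 0 z + 2 * V 0 1 z * U 0 1 z + V 0 0 z * \<Phi> 0 0 z" if "z \<in> \<Omega>" for z
    proof -
      have "A\<Phi> z + \<i> * (\<Phi> 0 2 z + complex_of_real b * \<Phi> 0 0 z)
        = (U 2 2 z + \<i> * U 0 4 z + Complex a b * U 0 2 z)
          + b * (U 2 0 z + \<i> * U 0 2 z + Complex a b * U 0 0 z)"
        unfolding A\<Phi>_def \<Phi>_def Cab by (simp add: algebra_simps numeral_eq_Suc)
      also have "\<dots> = V 0 2 z * U 0 0 z + 2 * V 0 1 z * U 0 1 z + V 0 0 z * U 0 2 z
          + b * (V 0 0 z * U 0 0 z)"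
        by (simp only: eigenvalue_equation_dyy[OF \<Omega> U V eq that] eq[OF that])
      finally show ?thesis by (simp add: \<Phi>_def algebra_simps numeral_eq_Suc)
    qed
    have N0: "N \<ge> 0" unfolding N_def by (intro integral_nonneg integrable_on_sq continuous_intros cU sub) simp
    have NaN: "N \<le> a * N" using N0 ab mult_right_mono[of 1 a N] by simp
    define J where "J = (\<lambda>z. (cmod (A z))\<^sup>2 + (cmod (\<Phi> 0 0 z))\<^sup>2 + (cmod (U 1 0 z))\<^sup>2 + (cmod (U 0 1 z))\<^sup>2)"
    have cJ: "continuous_on S J" if "S \<subseteq> \<Omega>" for S
      unfolding J_def by (intro continuous_intros cU c\<Phi> cA that)
    have J_le: "integral ?H J \<le> D1 * (a * N)"
    proof -
      have "integral ?H J \<le> C1 * (integral ?Q (\<lambda>z. (cmod (A z + \<i> * \<Phi> 0 0 z))\<^sup>2) + a * N)"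
        using est1[OF U sub ab] unfolding J_def A_def \<Phi>_def N_def by (simp add: numeral_2_eq_2)
      also have "integral ?Q (\<lambda>z. (cmod (A z + \<i> * \<Phi> 0 0 z))\<^sup>2) \<le> integral ?Q (\<lambda>z. K\<^sup>2 * (cmod (U 0 0 z))\<^sup>2)"
      proof (rule integral_le)
        fix z assume z: "z \<in> ?Q"
        have "(cmod (V 0 0 z))\<^sup>2 \<le> K\<^sup>2" using VK[OF z] by (intro power_mono) auto
        then show "(cmod (A z + \<i> * \<Phi> 0 0 z))\<^sup>2 \<le> K\<^sup>2 * (cmod (U 0 0 z))\<^sup>2"
          using z sub by (subst eqA) (auto simp: norm_mult power_mult_distrib intro!: mult_right_mono)
      qed (intro integrable_on_sq continuous_intros cA c\<Phi> cU sub)+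
      also have "\<dots> = K\<^sup>2 * N" unfolding N_def by simp
      also have "C1 * (K\<^sup>2 * N + a * N) \<le> C1 * (K\<^sup>2 * (a * N) + a * N)"
        using C1 NaN by (intro mult_left_mono add_right_mono) auto
      also have "\<dots> = D1 * (a * N)" by (simp add: D1_def algebra_simps)
      finally show ?thesis using C1 by simp
    qed
    have J_part: "integral ?H f \<le> D1 * (a * N)" if "continuous_on ?H f" "\<And>z. f z \<le> J z" for f
    proof -
      have "integral ?H f \<le> integral ?H J"
        by (intro integral_le integrable_on_sq cJ subH that)
      then show ?thesis using J_le by simp
    qed
    have \<Phi>_le: "integral ?H (\<lambda>z. (cmod (\<Phi> 0 0 z))\<^sup>2) \<le> D1 * (a * N)"
      by (rule J_part, intro continuous_intros c\<Phi> subH, simp add: J_def)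
    have A_le: "integral ?H (\<lambda>z. (cmod (A z))\<^sup>2) \<le> D1 * (a * N)"
      by (rule J_part, intro continuous_intros cA subH, simp add: J_def)
    have U_le: "integral ?H (\<lambda>z. (cmod (U 0 0 z))\<^sup>2) \<le> N"
      unfolding N_def using s by (intro integral_sq_mono continuous_intros cU sub) auto
    have A\<Phi>_le: "integral ?R (\<lambda>z. (cmod (A\<Phi> z))\<^sup>2) \<le> D2 * (a\<^sup>2 * N)"
    proof -
      define g where "g = (\<lambda>z. A\<Phi> z + \<i> * (\<Phi> 0 2 z + complex_of_real b * \<Phi> 0 0 z))"
      have cg: "continuous_on ?H g" unfolding g_def by (intro continuous_intros cA c\<Phi> subH)
      have "integral ?H (\<lambda>z. (cmod (g z))\<^sup>2) \<le> integral ?H (\<lambda>z. 12 * K\<^sup>2 * ((cmod (U 0 0 z))\<^sup>2 + J z))"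
      proof (rule integral_le)
        fix z assume z: "z \<in> ?H"
        have V2: "(cmod (V 0 j z))\<^sup>2 \<le> K\<^sup>2" if "j \<le> 2" for j
          using VK[of z j] that z HQ by (intro power_mono) auto
        have "(cmod (g z))\<^sup>2 \<le> 3 * ((cmod (V 0 2 z * U 0 0 z))\<^sup>2 + (cmod (2 * V 0 1 z * U 0 1 z))\<^sup>2 + (cmod (V 0 0 z * \<Phi> 0 0 z))\<^sup>2)"
          unfolding g_def using eqA\<Phi>[of z] z subH norm_sum3_squared_le by auto
        also have "\<dots> = 3 * ((cmod (V 0 2 z))\<^sup>2 * (cmod (U 0 0 z))\<^sup>2 + 4 * ((cmod (V 0 1 z))\<^sup>2 * (cmod (U 0 1 z))\<^sup>2) + (cmod (V 0 0 z))\<^sup>2 * (cmod (\<Phi> 0 0 z))\<^sup>2)"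
          by (simp add: norm_mult power_mult_distrib)
        also have "\<dots> \<le> 3 * (K\<^sup>2 * (cmod (U 0 0 z))\<^sup>2 + 4 * (K\<^sup>2 * (cmod (U 0 1 z))\<^sup>2) + K\<^sup>2 * (cmod (\<Phi> 0 0 z))\<^sup>2)"
          using V2 by (intro mult_left_mono add_mono mult_right_mono) auto
        also have "\<dots> = 12 * K\<^sup>2 * ((cmod (U 0 0 z))\<^sup>2 / 4 + (cmod (U 0 1 z))\<^sup>2 + (cmod (\<Phi> 0 0 z))\<^sup>2 / 4)"
          by (simp add: algebra_simps)
        also have "\<dots> \<le> 12 * K\<^sup>2 * ((cmod (U 0 0 z))\<^sup>2 + J z)"
        proof (rule mult_left_mono)
          have ar: "p / 4 + u + f / 4 \<le> p + (e + f + v + u)" if "p \<ge> 0" "e \<ge> 0" "f \<ge> 0" "v \<ge> 0" for p u f e v :: real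
            using that by simp
          show "(cmod (U 0 0 z))\<^sup>2 / 4 + (cmod (U 0 1 z))\<^sup>2 + (cmod (\<Phi> 0 0 z))\<^sup>2 / 4 \<le> (cmod (U 0 0 z))\<^sup>2 + J z"
            unfolding J_def by (rule ar) simp_all
        qed simp
        finally show "(cmod (g z))\<^sup>2 \<le> 12 * K\<^sup>2 * ((cmod (U 0 0 z))\<^sup>2 + J z)" .
      qed (intro integrable_on_sq continuous_intros cg cU cJ subH)+
      also have "\<dots> = 12 * K\<^sup>2 * (integral ?H (\<lambda>z. (cmod (U 0 0 z))\<^sup>2) + integral ?H J)"
        by (simp add: integral_add[OF integrable_on_sq integrable_on_sq] cJ[OF subH] cU[OF subH] continuous_intros)
      also have "\<dots> \<le> 12 * K\<^sup>2 * (a * N + D1 * (a * N))"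
        using J_le U_le NaN by (intro mult_left_mono) auto
      finally have g_le: "integral ?H (\<lambda>z. (cmod (g z))\<^sup>2) \<le> 12 * K\<^sup>2 * (1 + D1) * (a * N)"
        by (simp add: algebra_simps)
      have "integral ?R (\<lambda>z. (cmod (A\<Phi> z))\<^sup>2) \<le> integral ?R (\<lambda>z. (cmod (A\<Phi> z))\<^sup>2 + (cmod (\<Phi> 0 2 z + complex_of_real b * \<Phi> 0 0 z))\<^sup>2
          + (cmod (\<Phi> 1 0 z))\<^sup>2 + (cmod (\<Phi> 0 1 z))\<^sup>2)"
        by (intro integral_le integrable_on_sq continuous_intros cA c\<Phi> subR) simp
      also have "\<dots> \<le> C2 * (integral ?H (\<lambda>z. (cmod (g z))\<^sup>2) + a * integral ?H (\<lambda>z. (cmod (\<Phi> 0 0 z))\<^sup>2))"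
        using est2[OF \<Phi> subH ab] unfolding g_def A\<Phi>_def \<sigma>_def by simp
      also have "\<dots> \<le> C2 * (12 * K\<^sup>2 * (1 + D1) * (a * N) + a * (D1 * (a * N)))"
        using C2 g_le \<Phi>_le ab by (intro mult_left_mono add_mono) auto
      also have "\<dots> \<le> C2 * (12 * K\<^sup>2 * (1 + D1) * (a * (a * N)) + a * (D1 * (a * N)))"
        using C2 D ab NaN by (intro mult_left_mono add_right_mono) auto
      also have "\<dots> = D2 * (a\<^sup>2 * N)" by (simp add: D2_def algebra_simps power2_eq_square)
      finally show ?thesis .
    qed
    have R_le: "integral ?R f \<le> integral ?H f" if "continuous_on ?H f" "\<And>z. f z \<ge> 0"
      for f :: "real \<times> real \<Rightarrow> real"
      by (rule integral_sq_mono[OF _ that]) (use s in \<open>simp add: \<sigma>_def\<close>)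
    have U_le_R: "integral ?R (\<lambda>z. (cmod (U 0 0 z))\<^sup>2) \<le> N"
      by (rule order_trans[OF R_le U_le]) (intro continuous_intros cU subH, simp)
    have A_le_R: "integral ?R (\<lambda>z. (cmod (A z))\<^sup>2) \<le> D1 * (a * N)"
      by (rule order_trans[OF R_le A_le]) (intro continuous_intros cA subH, simp)
    have \<Phi>_le_R: "integral ?R (\<lambda>z. (cmod (\<Phi> 0 0 z))\<^sup>2) \<le> D1 * (a * N)"
      by (rule order_trans[OF R_le \<Phi>_le]) (intro continuous_intros c\<Phi> subH, simp)
    have "integral {y - \<sigma>..y + \<sigma>} (\<lambda>q. (cmod (U 0 0 (x, q)))\<^sup>2) \<le> 139 * m\<^sup>2 *
      (1 / \<sigma> * integral ?R (\<lambda>z. (cmod (U 0 0 z))\<^sup>2) + \<sigma> / a * integral ?R (\<lambda>z. (cmod (A z))\<^sup>2))"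
      unfolding A_def m_def by (rule center_line_bound[OF \<sigma> ab(3) U subR])
    also have "\<dots> \<le> 139 * m\<^sup>2 * (1 / \<sigma> * N + \<sigma> / a * (D1 * (a * N)))"
      using \<sigma> ab U_le_R A_le_R by (intro mult_left_mono add_mono) auto
    also have "\<dots> = E1 * N" using ab by (simp add: E1_def field_simps)
    finally have line_U: "integral {y - \<sigma>..y + \<sigma>} (\<lambda>q. (cmod (U 0 0 (x, q)))\<^sup>2) \<le> E1 * N" .
    have "integral {y - \<sigma>..y + \<sigma>} (\<lambda>q. (cmod (\<Phi> 0 0 (x, q)))\<^sup>2) \<le> 139 * m\<^sup>2 *
      (1 / \<sigma> * integral ?R (\<lambda>z. (cmod (\<Phi> 0 0 z))\<^sup>2) + \<sigma> / a * integral ?R (\<lambda>z. (cmod (A\<Phi> z))\<^sup>2))"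
      unfolding A\<Phi>_def m_def by (rule center_line_bound[OF \<sigma> ab(3) \<Phi> subR])
    also have "\<dots> \<le> 139 * m\<^sup>2 * (1 / \<sigma> * (D1 * (a * N)) + \<sigma> / a * (D2 * (a\<^sup>2 * N)))"
      using \<sigma> ab \<Phi>_le_R A\<Phi>_le by (intro mult_left_mono add_mono) auto
    also have "\<dots> = E2 * (a * N)" using ab by (simp add: E2_def field_simps power2_eq_square)
    finally have line_\<Phi>: "integral {y - \<sigma>..y + \<sigma>} (\<lambda>q. (cmod (\<Phi> 0 0 (x, q)))\<^sup>2) \<le> E2 * (a * N)" .
    define \<beta> where "\<beta> = max b (sqrt a)"
    have \<beta>: "\<beta> \<ge> 1" "sqrt a \<le> \<beta>" "b \<le> \<beta>" "\<beta> \<le> a" "\<beta> - b \<le> sqrt a"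
    proof -
      have "1 \<le> sqrt a" using ab by simp
      moreover from this have "sqrt a * 1 \<le> sqrt a * sqrt a" by (intro mult_left_mono) auto
      then have "sqrt a \<le> a" using ab by simp
      ultimately show "\<beta> \<ge> 1" "sqrt a \<le> \<beta>" "b \<le> \<beta>" "\<beta> \<le> a" "\<beta> - b \<le> sqrt a"
        using ab unfolding \<beta>_def by linarith+
    qed
    show "(cmod (U 0 0 (x, y)))\<^sup>2 \<le> C * sqrt (a / max b (sqrt a)) * integral ?Q (\<lambda>z. (cmod (U 0 0 z))\<^sup>2)"
    proof -
      \<comment> \<open>The optimal length is \<open>l = \<sigma> sqrt (\<beta> / a)\<close>: it balances the average of \<open>u\<close> against the work of
        the forcing. Using the frequency \<open>sqrt \<beta>\<close> in place of \<open>sqrt b\<close> keeps \<open>l\<close> at least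
        comparable with a wavelength and changes the forcing by at most \<open>sqrt a * \<bar>u\<bar>\<close>.\<close>
      define \<rho> where "\<rho> = sqrt (a / \<beta>)"
      define l where "l = \<sigma> / \<rho>"
      have \<rho>2: "\<rho>\<^sup>2 = a / \<beta>" using ab \<beta>(1) by (simp add: \<rho>_def)
      have \<rho>: "\<rho> \<ge> 1" using \<beta> by (simp add: \<rho>_def)
      have l: "l > 0" "l \<le> \<sigma>" using \<sigma> \<rho> by (simp_all add: l_def field_simps)
      let ?L = "{y - l..y + l}" and ?S = "{y - \<sigma>..y + \<sigma>}"
      have LS: "?L \<subseteq> ?S" using l by auto
      have mem: "(x, q) \<in> \<Omega>" if "q \<in> ?S" for q using that subR \<sigma> by (auto simp: mem_sq)
      have cline: "continuous_on T (\<lambda>q. f (x, q))" if "T \<subseteq> ?S" "continuous_on \<Omega> f"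
        for T and f :: "real \<times> real \<Rightarrow> complex"
        by (rule continuous_on_compose2[OF that(2)]) (use that(1) mem in \<open>auto intro!: continuous_intros\<close>)
      note cUl = cline[OF _ cU[OF order_refl]] and c\<Phi>l = cline[OF _ c\<Phi>[OF order_refl]]
      define X where "X = integral ?L (\<lambda>q. (cmod (U 0 0 (x, q)))\<^sup>2)"
      define Y where "Y = integral ?L (\<lambda>q. (cmod (U 0 2 (x, q) + complex_of_real ((sqrt \<beta>)\<^sup>2) * U 0 0 (x, q)))\<^sup>2)"
      have "1 / l = \<rho> / \<sigma>" by (simp add: l_def)
      also have "\<dots> \<le> sqrt \<beta> * m"
      proof -
        have "(sqrt a)\<^sup>2 \<le> \<beta>\<^sup>2" using \<beta>(2) ab by (intro power_mono) auto
        then have "a / \<beta> \<le> \<beta>" using ab \<beta>(1) by (simp add: field_simps power2_eq_square)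
        then have "\<rho> \<le> sqrt \<beta>" by (simp add: \<rho>_def)
        then have "\<rho> * (1 / \<sigma>) \<le> sqrt \<beta> * m" using \<rho> m \<sigma> \<beta>(1) by (intro mult_mono) auto
        then show ?thesis by simp
      qed
      finally have lm: "1 / l \<le> m * sqrt \<beta>" by (simp add: mult.commute)
      have "(sqrt \<beta>)\<^sup>2 * (cmod (U 0 0 (x, y)))\<^sup>2 \<le> 139 * m\<^sup>2 * ((sqrt \<beta>)\<^sup>2 / l * X + l * Y)"
        unfolding X_def Y_def
      proof (rule interval_bound[OF l(1) _ m(1) lm])
        fix q assume q: "q \<in> ?L"
        then have q': "(x, q) \<in> \<Omega>" using LS mem by blast
        show "((\<lambda>q. U 0 0 (x, q)) has_vector_derivative U 0 1 (x, q)) (at q within ?L)"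
          using jet_on_dy[OF U q', of 0 0] by simp
        show "((\<lambda>q. U 0 1 (x, q)) has_vector_derivative U 0 2 (x, q)) (at q within ?L)"
          using jet_on_dy[OF U q', of 0 1] by (simp add: numeral_2_eq_2)
      qed (use \<beta> cUl[OF LS] in auto)
      then have main: "\<beta> * (cmod (U 0 0 (x, y)))\<^sup>2 \<le> 139 * m\<^sup>2 * (\<beta> / l * X + l * Y)"
        using \<beta>(1) by simp
      have X_le: "X \<le> E1 * N"
      proof -
        have "X \<le> integral ?S (\<lambda>q. (cmod (U 0 0 (x, q)))\<^sup>2)"
          unfolding X_def
          by (intro integral_subset_le integrable_continuous_real continuous_intros cUl LS) auto
        then show ?thesis using line_U by simp
      qed
      have Y_le: "Y \<le> (2 * E1 + 2 * E2) * (a * N)"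
      proof -
        have "Y \<le> integral ?L (\<lambda>q. 2 * (cmod (\<Phi> 0 0 (x, q)))\<^sup>2 + 2 * a * (cmod (U 0 0 (x, q)))\<^sup>2)"
          unfolding Y_def
        proof (rule integral_le)
          fix q assume "q \<in> ?L"
          have e: "U 0 2 (x, q) + complex_of_real ((sqrt \<beta>)\<^sup>2) * U 0 0 (x, q)
              = \<Phi> 0 0 (x, q) + complex_of_real (\<beta> - b) * U 0 0 (x, q)"
            using \<beta>(1) by (simp add: \<Phi>_def algebra_simps numeral_2_eq_2)
          have "(\<beta> - b)\<^sup>2 \<le> (sqrt a)\<^sup>2" using \<beta> by (intro power_mono) auto
          then have "(\<beta> - b)\<^sup>2 * (cmod (U 0 0 (x, q)))\<^sup>2 \<le> a * (cmod (U 0 0 (x, q)))\<^sup>2"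
            using ab by (intro mult_right_mono) auto
          moreover have "(cmod (p + r))\<^sup>2 \<le> 2 * (cmod p)\<^sup>2 + 2 * (cmod r)\<^sup>2" for p r :: complex
          proof -
            have "(cmod (p + r))\<^sup>2 \<le> (cmod p + cmod r)\<^sup>2"
              by (intro power_mono norm_triangle_ineq norm_ge_zero)
            also have "\<dots> \<le> 2 * (cmod p)\<^sup>2 + 2 * (cmod r)\<^sup>2"
              using zero_le_power2[of "cmod p - cmod r"] by (simp add: power2_eq_square algebra_simps)
            finally show ?thesis .
          qed
          note this[of "\<Phi> 0 0 (x, q)" "complex_of_real (\<beta> - b) * U 0 0 (x, q)"]
          ultimately show "(cmod (U 0 2 (x, q) + complex_of_real ((sqrt \<beta>)\<^sup>2) * U 0 0 (x, q)))\<^sup>2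
              \<le> 2 * (cmod (\<Phi> 0 0 (x, q)))\<^sup>2 + 2 * a * (cmod (U 0 0 (x, q)))\<^sup>2"
            unfolding e by (simp only: norm_mult norm_of_real power_mult_distrib power2_abs)
        qed (intro integrable_continuous_real continuous_intros cUl c\<Phi>l LS)+
        also have "\<dots> \<le> integral ?S (\<lambda>q. 2 * (cmod (\<Phi> 0 0 (x, q)))\<^sup>2 + 2 * a * (cmod (U 0 0 (x, q)))\<^sup>2)"
          using ab
          by (intro integral_subset_le integrable_continuous_real continuous_intros cUl c\<Phi>l LS order_refl) auto
        also have "\<dots> = 2 * integral ?S (\<lambda>q. (cmod (\<Phi> 0 0 (x, q)))\<^sup>2) + 2 * a * integral ?S (\<lambda>q. (cmod (U 0 0 (x, q)))\<^sup>2)"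
          by (intro integral_unique has_integral_add has_integral_mult_right integrable_integral
              integrable_continuous_real continuous_intros cUl c\<Phi>l order_refl)
        also have "\<dots> \<le> 2 * (E2 * (a * N)) + 2 * a * (E1 * N)"
          using line_U line_\<Phi> ab by (intro add_mono mult_left_mono) auto
        finally show ?thesis by (simp add: algebra_simps)
      qed
      have "\<beta> * (cmod (U 0 0 (x, y)))\<^sup>2 \<le> 139 * m\<^sup>2 * (\<beta> / l * (E1 * N) + l * ((2 * E1 + 2 * E2) * (a * N)))"
        using X_le Y_le l \<beta>(1) by (intro order_trans[OF main] mult_left_mono add_mono) auto
      also have "a = \<beta> * \<rho>\<^sup>2" using \<beta>(1) by (simp add: \<rho>2)
      also have "139 * m\<^sup>2 * (\<beta> / l * (E1 * N) + l * ((2 * E1 + 2 * E2) * (\<beta> * \<rho>\<^sup>2 * N))) = \<beta> * (C * \<rho> * N)"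
        using \<rho> \<sigma> by (simp add: C_def l_def field_simps power2_eq_square)
      finally have "(cmod (U 0 0 (x, y)))\<^sup>2 \<le> C * \<rho> * N" using \<beta>(1) by simp
      then show ?thesis by (simp add: \<rho>_def \<beta>_def N_def)
    qed
  qed
qed

section \<open>From squares to discs, and the reflection\<close>

text \<open>
  With \<open>\<beta> = max b (sqrt a)\<close> both branches of \<open>Feps\<close> are \<open>a powr \<epsilon>\<close> times the one expression
  \<open>(a / \<beta>) powr (1/4)\<close>.
\<close>

lemma sqrt_sqrt_le_Feps:
  assumes "1 \<le> a" "0 < b" "0 < \<epsilon>"
  shows "sqrt (sqrt (a / max b (sqrt a))) \<le> Feps \<epsilon> a b"
proof -
  have root4: "sqrt (sqrt t) = t powr (1/4)" if "t > 0" for t :: real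
    using that by (simp add: powr_half_sqrt[symmetric] powr_powr)
  have sqrt_a: "sqrt a = a powr (1/2)" using assms(1) by (simp add: powr_half_sqrt)
  have e: "a powr c \<le> a powr (c + \<epsilon>)" for c using assms by (intro powr_mono) auto
  show ?thesis
  proof (cases "a powr (1/2) \<le> b")
    case True
    then have "sqrt (sqrt (a / max b (sqrt a))) = (a / b) powr (1/4)"
      using assms by (subst root4) (auto simp: sqrt_a max_def)
    also have "\<dots> = a powr (1/4) * b powr (- 1/4)"
      using assms by (simp add: powr_divide powr_minus field_simps)
    also have "\<dots> \<le> a powr (1/4 + \<epsilon>) * b powr (- 1/4)"
      using e by (intro mult_right_mono) auto
    finally show ?thesis using True by (simp add: Feps_def)
  next
    case False
    then have "a / max b (sqrt a) = a powr (1/2)"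
      using assms real_div_sqrt[of a] by (simp add: max_def flip: sqrt_a)
    then have "sqrt (sqrt (a / max b (sqrt a))) = a powr (1/8)"
      using assms by (subst root4) (auto simp: powr_powr)
    also have "\<dots> \<le> a powr (1/8 + \<epsilon>)" by (rule e)
    finally show ?thesis using False by (simp add: Feps_def)
  qed
qed

text \<open>
  Conjugating \<open>- u\<^sub>x\<^sub>x - \<i> u\<^sub>y\<^sub>y + V u = l u\<close> and multiplying by \<open>\<i>\<close> gives
  \<open>- v\<^sub>y\<^sub>y - \<i> v\<^sub>x\<^sub>x + \<i> (cnj V) v = \<i> (cnj l) v\<close> for \<open>v = cnj u\<close>, which after the exchange of \<open>x\<close> and
  \<open>y\<close> is the original equation with real and imaginary part of \<open>l\<close> exchanged. The factor \<open>c\<close> is \<open>1\<close> for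
  the eigenfunction and \<open>\<i>\<close> for the potential.
\<close>

lemma jet_on_reflect:
  assumes "jet_on \<Omega> U"
  shows "jet_on (prod.swap -` \<Omega>) (\<lambda>i j z. c * cnj (U j i (prod.swap z)))"
  unfolding jet_on_def
proof (intro conjI allI impI)
  fix i j
  show "continuous_on (prod.swap -` \<Omega>) (\<lambda>z. c * cnj (U j i (prod.swap z)))"
    by (intro continuous_intros continuous_on_compose2[OF jet_on_cont[OF assms order_refl, of j i]] continuous_on_swap)
       auto
next
  fix i j and x y :: real
  assume "(x, y) \<in> prod.swap -` \<Omega>"
  then have z: "(y, x) \<in> \<Omega>" by simp
  show "((\<lambda>t. c * cnj (U j i (prod.swap (t, y)))) has_vector_derivative
      c * cnj (U j (Suc i) (prod.swap (x, y)))) (at x)"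
    using jet_on_dy[OF assms z, of j i UNIV]
    by (intro has_vector_derivative_mult_right) (simp add: has_vector_derivative_cnj)
  show "((\<lambda>t. c * cnj (U j i (prod.swap (x, t)))) has_vector_derivative
      c * cnj (U (Suc j) i (prod.swap (x, y)))) (at y)"
    using jet_on_dx[OF assms z, of j i UNIV]
    by (intro has_vector_derivative_mult_right) (simp add: has_vector_derivative_cnj)
qed

lemma integral_sq_swap:
  fixes f :: "real \<times> real \<Rightarrow> real"
  assumes "continuous_on (sq x y s) f"
  shows "integral (sq y x s) (\<lambda>z. f (prod.swap z)) = integral (sq x y s) f"
  using integral_swap_2dim[of "x - s" "y - s" "x + s" "y + s" "\<lambda>p q. f (p, q)"] assms
  by (simp add: sq_def case_prod_unfold prod.swap_def)

lemma sq_subset_cball: "sq x y (r / 2) \<subseteq> cball (x, y) r"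
proof (clarsimp simp: mem_sq dist_norm)
  fix p q assume pq: "x - r / 2 \<le> p" "p \<le> x + r / 2" "y - r / 2 \<le> q" "q \<le> y + r / 2"
  have "norm (x - p, y - q) \<le> \<bar>x - p\<bar> + \<bar>y - q\<bar>"
    using norm_Pair_le[of "x - p" "y - q"] by simp
  also have "\<dots> \<le> r" using pq by linarith
  finally show "norm (x - p, y - q) \<le> r" .
qed

lemma integral_sq_le_L2norm:
  assumes r: "r > 0" and cont: "continuous_on (cball (x, y) r) f"
  shows "sqrt (integral (sq x y (r / 2)) (\<lambda>z. (cmod (f z))\<^sup>2)) \<le> L2norm_on (cball (x, y) r) f"
proof -
  note sub = sq_subset_cball[of x y r]
  have int: "set_integrable lborel (cball (x, y) r) (\<lambda>z. (cmod (f z))\<^sup>2)"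
    unfolding set_integrable_def
    by (intro borel_integrable_compact continuous_intros cont) auto
  have "integral (sq x y (r / 2)) (\<lambda>z. (cmod (f z))\<^sup>2) \<le> integral (cball (x, y) r) (\<lambda>z. (cmod (f z))\<^sup>2)"
    using continuous_on_subset[OF cont sub] set_borel_integral_eq_integral(1)[OF int]
    by (intro integral_subset_le sub integrable_on_sq continuous_intros) auto
  then show ?thesis
    unfolding L2norm_on_def set_borel_integral_eq_integral(2)[OF int] by simp
qed

lemma cmod_pure_derivative:
  assumes V: "smooth_fun_on \<Omega> V" and z: "z \<in> \<Omega>" and j: "j \<le> 2"
  shows "cmod ((pdy ^^ j) V z) = cmod (Dmulti (0, j) V z)"
    and "cmod ((pdx ^^ j) V z) = cmod (Dmulti (j, 0) V z)"
proof -
  obtain x y where xy: "z = (x, y)" by force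
  have j': "j = 0 \<or> j = 1 \<or> j = 2" using j by auto
  have "pdy (\<lambda>w. - \<i> * pdy V w) (x, y) = - \<i> * pdy (pdy V) (x, y)"
    unfolding pdy_def[of "\<lambda>w. - \<i> * pdy V w"] prod.case
    by (intro vector_derivative_at has_vector_derivative_mult_right has_vector_derivative_pdy
        smooth_fun_on_differentiable[OF smooth_fun_on_pdy[OF V]] z[unfolded xy])
  then show "cmod ((pdy ^^ j) V z) = cmod (Dmulti (0, j) V z)"
    using j' by (elim disjE) (simp_all add: Dmulti_def xy numeral_2_eq_2 norm_mult)
  have "pdx (\<lambda>w. - \<i> * pdx V w) (x, y) = - \<i> * pdx (pdx V) (x, y)"
    unfolding pdx_def[of "\<lambda>w. - \<i> * pdx V w"] prod.case
    by (intro vector_derivative_at has_vector_derivative_mult_right has_vector_derivative_pdx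
        smooth_fun_on_differentiable[OF smooth_fun_on_pdx[OF V]] z[unfolded xy])
  then show "cmod ((pdx ^^ j) V z) = cmod (Dmulti (j, 0) V z)"
    using j' by (elim disjE) (simp_all add: Dmulti_def xy numeral_2_eq_2 norm_mult)
qed

theorem mainTheorem4:
  fixes \<epsilon> r :: real and M :: "nat \<times> nat \<Rightarrow> real"
  assumes "\<epsilon> > 0" and "r > 0" and "\<forall>\<beta>. M \<beta> \<ge> 0"
  shows "\<exists>C \<Lambda> :: real. C > 0 \<and> \<Lambda> > 0 \<and>
    (\<forall>(\<Omega> :: (real \<times> real) set) (V :: real \<times> real \<Rightarrow> complex) (l :: complex)
       (\<psi> :: real \<times> real \<Rightarrow> complex) (x :: real \<times> real).
       open \<Omega> \<and> smooth_fun_on \<Omega> V \<and> smooth_fun_on \<Omega> \<psi> \<and>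
       (\<forall>z\<in>\<Omega>. Hop \<psi> z + V z * \<psi> z = l * \<psi> z) \<and>
       cball x r \<subseteq> \<Omega> \<and>
       (\<forall>\<beta>. \<forall>z\<in>cball x r. cmod (Dmulti \<beta> V z) \<le> M \<beta>) \<longrightarrow>
       (0 < Im l \<and> Im l \<le> Re l \<and> Re l \<ge> \<Lambda> \<longrightarrow>
          cmod (\<psi> x) \<le> C * Feps \<epsilon> (Re l) (Im l) * L2norm_on (cball x r) \<psi>) \<and>
       (0 < Re l \<and> Re l \<le> Im l \<and> Im l \<ge> \<Lambda> \<longrightarrow>
          cmod (\<psi> x) \<le> C * Feps \<epsilon> (Im l) (Re l) * L2norm_on (cball x r) \<psi>))"
proof -
  define K where "K = M (0, 0) + M (0, 1) + M (0, 2) + M (1, 0) + M (2, 0)"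
  define s where "s = r / 2"
  have s: "s > 0" using assms(2) by (simp add: s_def)
  have MK: "M (0, j) \<le> K" "M (j, 0) \<le> K" if "j \<le> 2" for j
  proof -
    have "j = 0 \<or> j = 1 \<or> j = 2" using that by auto
    moreover have "M \<beta> \<ge> 0" for \<beta> using assms(3) by blast
    from this[of "(0, 0)"] this[of "(0, 1)"] this[of "(0, 2)"] this[of "(1, 0)"] this[of "(2, 0)"]
    have "M (0, 0) \<le> K" "M (0, 1) \<le> K" "M (0, 2) \<le> K" "M (1, 0) \<le> K" "M (2, 0) \<le> K"
      unfolding K_def by linarith+
    ultimately show "M (0, j) \<le> K" "M (j, 0) \<le> K" by auto
  qed
  have K: "K \<ge> 0" using assms(3) MK(1)[of 0] order_trans[of 0 "M (0, 0)" K] by simp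
  obtain C where C: "C > 0" and bound: "\<And>\<Omega> U V x y a b. open \<Omega> \<Longrightarrow> jet_on \<Omega> U \<Longrightarrow> jet_on \<Omega> V \<Longrightarrow> sq x y s \<subseteq> \<Omega> \<Longrightarrow>
      0 \<le> b \<Longrightarrow> b \<le> a \<Longrightarrow> 1 \<le> a \<Longrightarrow>
      (\<And>z. z \<in> \<Omega> \<Longrightarrow> U 2 0 z + \<i> * U 0 2 z + Complex a b * U 0 0 z = V 0 0 z * U 0 0 z) \<Longrightarrow>
      (\<And>z j. z \<in> sq x y s \<Longrightarrow> j \<le> 2 \<Longrightarrow> cmod (V 0 j z) \<le> K) \<Longrightarrow>
      (cmod (U 0 0 (x, y)))\<^sup>2 \<le> C * sqrt (a / max b (sqrt a)) * integral (sq x y s) (\<lambda>z. (cmod (U 0 0 z))\<^sup>2)"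
    using jet_eigenfunction_bound[OF s K] by blast
  have key: "(0 < Im l \<and> Im l \<le> Re l \<and> Re l \<ge> 1 \<longrightarrow>
        cmod (\<psi> c) \<le> sqrt C * Feps \<epsilon> (Re l) (Im l) * L2norm_on (cball c r) \<psi>) \<and>
      (0 < Re l \<and> Re l \<le> Im l \<and> Im l \<ge> 1 \<longrightarrow>
        cmod (\<psi> c) \<le> sqrt C * Feps \<epsilon> (Im l) (Re l) * L2norm_on (cball c r) \<psi>)"
    if H: "open \<Omega> \<and> smooth_fun_on \<Omega> V \<and> smooth_fun_on \<Omega> \<psi> \<and>
       (\<forall>z\<in>\<Omega>. Hop \<psi> z + V z * \<psi> z = l * \<psi> z) \<and> cball c r \<subseteq> \<Omega> \<and>
       (\<forall>\<beta>. \<forall>z\<in>cball c r. cmod (Dmulti \<beta> V z) \<le> M \<beta>)"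
    for \<Omega> :: "(real \<times> real) set" and V \<psi> :: "real \<times> real \<Rightarrow> complex" and l :: complex and c :: "real \<times> real"
  proof -
    obtain x y where c: "c = (x, y)" by force
    define U where "U = (\<lambda>i j. (pdx ^^ i) ((pdy ^^ j) \<psi>))"
    define W where "W = (\<lambda>i j. (pdx ^^ i) ((pdy ^^ j) V))"
    have \<Omega>: "open \<Omega>" and U: "jet_on \<Omega> U" and W: "jet_on \<Omega> W"
      using H smooth_imp_jet_on unfolding U_def W_def by auto
    have ballsub: "cball (x, y) r \<subseteq> \<Omega>" using H c by simp
    have sqsub: "sq x y s \<subseteq> cball (x, y) r"
      unfolding s_def by (rule sq_subset_cball)
    have sub: "sq x y s \<subseteq> \<Omega>" using sqsub ballsub by blast
    have eq: "U 2 0 z + \<i> * U 0 2 z + l * U 0 0 z = W 0 0 z * U 0 0 z" if "z \<in> \<Omega>" for z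
    proof -
      have "Hop \<psi> z + V z * \<psi> z = l * \<psi> z" using H that by blast
      then show ?thesis by (simp add: Hop_def U_def W_def numeral_2_eq_2 algebra_simps)
    qed
    have WK: "cmod (W 0 j z) \<le> K" "cmod (W j 0 z) \<le> K" if "z \<in> sq x y s" "j \<le> 2" for z j
    proof -
      have "cmod (Dmulti \<beta> V z) \<le> M \<beta>" for \<beta> using H that(1) sqsub c by blast
      from this[of "(0, j)"] this[of "(j, 0)"] show "cmod (W 0 j z) \<le> K" "cmod (W j 0 z) \<le> K"
        using cmod_pure_derivative[of \<Omega> V z j] H that sub MK[OF that(2)] by (auto simp: W_def)
    qed
    define N where "N = integral (sq x y s) (\<lambda>z. (cmod (\<psi> z))\<^sup>2)"
    have NL: "sqrt N \<le> L2norm_on (cball c r) \<psi>"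
      unfolding N_def s_def c
      by (rule integral_sq_le_L2norm[OF assms(2)])
         (use jet_on_cont[OF U ballsub, of 0 0] in \<open>simp add: U_def\<close>)
    have N0: "0 \<le> sqrt N"
      unfolding N_def using jet_on_cont[OF U sub, of 0 0]
      by (intro real_sqrt_ge_zero integral_nonneg integrable_on_sq continuous_intros) (auto simp: U_def)
    have fin: "cmod (\<psi> c) \<le> sqrt C * Feps \<epsilon> a b * L2norm_on (cball c r) \<psi>"
      if "1 \<le> a" "0 < b" and le: "(cmod (\<psi> c))\<^sup>2 \<le> C * sqrt (a / max b (sqrt a)) * N" for a b
    proof -
      have "cmod (\<psi> c) \<le> sqrt (C * sqrt (a / max b (sqrt a)) * N)"
        using le by (rule real_le_rsqrt)
      also have "\<dots> = sqrt C * sqrt (sqrt (a / max b (sqrt a))) * sqrt N"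
        by (simp add: real_sqrt_mult)
      also have "\<dots> \<le> sqrt C * Feps \<epsilon> a b * L2norm_on (cball c r) \<psi>"
      proof (intro mult_mono NL N0)
        show "sqrt (sqrt (a / max b (sqrt a))) \<le> Feps \<epsilon> a b"
          by (rule sqrt_sqrt_le_Feps[OF that(1,2) assms(1)])
        show "0 \<le> sqrt (sqrt (a / max b (sqrt a)))" using that(1) by (simp add: le_max_iff_disj)
        show "0 \<le> sqrt C * Feps \<epsilon> a b" using C by (simp add: Feps_def)
      qed (use C in auto)
      finally show ?thesis .
    qed
    show ?thesis
    proof (intro conjI impI)
      assume l: "0 < Im l \<and> Im l \<le> Re l \<and> 1 \<le> Re l"
      show "cmod (\<psi> c) \<le> sqrt C * Feps \<epsilon> (Re l) (Im l) * L2norm_on (cball c r) \<psi>"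
      proof (rule fin)
        show "(cmod (\<psi> c))\<^sup>2 \<le> C * sqrt (Re l / max (Im l) (sqrt (Re l))) * N"
          using bound[OF \<Omega> U W sub, of "Im l" "Re l"] l eq WK(1) by (simp add: U_def N_def c)
      qed (use l in auto)
    next
      assume l: "0 < Re l \<and> Re l \<le> Im l \<and> 1 \<le> Im l"
      define U' where "U' = (\<lambda>i j z. 1 * cnj (U j i (prod.swap z)))"
      define W' where "W' = (\<lambda>i j z. \<i> * cnj (W j i (prod.swap z)))"
      have "prod.swap z \<in> sq x y s" if "z \<in> sq y x s" for z
        using that by (cases z) (auto simp: mem_sq)
      then have swap_sub: "sq y x s \<subseteq> prod.swap -` \<Omega>" using sub by blast
      have "(cmod (U' 0 0 (y, x)))\<^sup>2 \<le> C * sqrt (Im l / max (Re l) (sqrt (Im l))) * integral (sq y x s) (\<lambda>z. (cmod (U' 0 0 z))\<^sup>2)"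
      proof (rule bound[where U = U' and V = W' and \<Omega> = "prod.swap -` \<Omega>"])
        show "open (prod.swap -` \<Omega>)"
          using \<Omega> by (intro open_vimage continuous_on_swap)
        show "jet_on (prod.swap -` \<Omega>) U'" "jet_on (prod.swap -` \<Omega>) W'"
          unfolding U'_def W'_def by (rule jet_on_reflect[OF U] jet_on_reflect[OF W])+
        show "U' 2 0 z + \<i> * U' 0 2 z + Complex (Im l) (Re l) * U' 0 0 z = W' 0 0 z * U' 0 0 z"
          if "z \<in> prod.swap -` \<Omega>" for z
        proof -
          have "\<i> * cnj (U 2 0 (prod.swap z) + \<i> * U 0 2 (prod.swap z) + l * U 0 0 (prod.swap z))
              = \<i> * cnj (W 0 0 (prod.swap z) * U 0 0 (prod.swap z))"
            using eq[of "prod.swap z"] that by simp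
          moreover have "Complex (Im l) (Re l) = \<i> * cnj l" by (simp add: complex_eq_iff)
          ultimately show ?thesis unfolding U'_def W'_def by (simp add: algebra_simps)
        qed
        show "cmod (W' 0 j z) \<le> K" if "z \<in> sq y x s" "j \<le> 2" for z j
        proof -
          have "prod.swap z \<in> sq x y s" using that(1) by (cases z) (auto simp: mem_sq)
          then show ?thesis using WK(2) that(2) by (simp add: W'_def norm_mult)
        qed
      qed (use l swap_sub in auto)
      moreover have "integral (sq y x s) (\<lambda>z. (cmod (U' 0 0 z))\<^sup>2) = N"
        using integral_sq_swap[of x y s "\<lambda>z. (cmod (\<psi> z))\<^sup>2"] jet_on_cont[OF U sub, of 0 0]
        by (simp add: U'_def U_def N_def continuous_intros)
      ultimately have "(cmod (\<psi> c))\<^sup>2 \<le> C * sqrt (Im l / max (Re l) (sqrt (Im l))) * N"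
        by (simp add: U'_def U_def c)
      then show "cmod (\<psi> c) \<le> sqrt C * Feps \<epsilon> (Im l) (Re l) * L2norm_on (cball c r) \<psi>"
        using l by (intro fin) auto
    qed
  qed
  show ?thesis
    using C key by (intro exI[of _ "sqrt C"] exI[of _ "1 :: real"] conjI[OF _ conjI] allI impI) auto
qed

end
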